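(* Let $\Bbbk$ be a field of characteristic $\mathrm{char}(\Bbbk)\neq 2$, let $n\ge 1$, and let $\mathcal{R}=R_A$ ($A\in M_n(\Bbbk)$) be a quasitriangular structure on $E(n)$. Let $\chi=\sum_{p,q=1}^n\gamma_{pq}\,gx_p\otimes x_q$ with $\gamma_{pq}\in\Bbbk$ be the given pre-Cartier structure (infinitesimal $\mathcal{R}$-matrix) on the quasitriangular Hopf algebra $(E(n),\mathcal{R})$. Then $$\mathcal{R}\exp(\hbar\chi)=\mathcal{R}\Big(1\otimes 1+\hbar\chi+\cdots+\frac{\hbar^n}{n!}\chi^n\Big)$$ is a quasitriangular structure on the trivial topological bialgebra $E(n)[[\hbar]]$.
   Context: $E(n)$ is the $2^{n+1}$-dimensional Hopf algebra over $\Bbbk$ generated as an algebra by $g,x_1,\dots,x_n$ with relations $g^2=1$, $x_i^2=0$, $gx_i=-x_ig$, $x_ix_j=-x_jx_i$ for all $i,j$, and with $\Delta(g)=g\otimes g$, $\Delta(x_i)=x_i\otimes 1+g\otimes x_i$, $\varepsilon(g)=1$, $\varepsilon(x_i)=0$, $S(g)=g$, $S(x_i)=-gx_i$. For $P=\{i_1<\dots<i_s\}\subseteq\{1,\dots,n\}$ put $x_P=x_{i_1}\cdots x_{i_s}$, $x_\emptyset=1$. The quasitriangular structures on $E(n)$ are known to be exactly the elements, for $A\in M_n(\Bbbk)$, $$R_A=\tfrac12(1\otimes 1+1\otimes g+g\otimes 1-g\otimes g)+\tfrac12\sum_{|F|=|P|}(-1)^{\frac{|P|(|P|-1)}{2}}\det(P,F)\big(g^{|P|}x_F\otimes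 x_P+g^{|P|}x_F\otimes gx_P+g^{|P|+1}x_F\otimes x_P-g^{|P|+1}x_F\otimes gx_P\big),$$ where $P,F$ run over nonempty subsets of $\{1,\dots,n\}$ with $|F|=|P|$ and $\det(P,F)$ is the determinant of the submatrix of $A$ with rows indexed by $P$ and columns indexed by $F$. For a bialgebra $H$ and $T=\sum_i T^i\otimes T_i\in H\otimes H$ write $T_{12}=T\otimes 1$, $T_{23}=1\otimes T$, $T_{13}=\sum_i T^i\otimes 1\otimes T_i$. A quasitriangular structure on $H$ is an invertible $\mathcal{R}\in H\otimes H$ with $\Delta^{\mathrm{op}}(h)=\mathcal{R}\Delta(h)\mathcal{R}^{-1}$ for all $h$ (where $\Delta^{\mathrm{op}}$ is $\Delta$ followed by the flip), $(\mathrm{Id}\otimes\Delta)(\mathcal{R})=\mathcal{R}_{13}\mathcal{R}_{12}$, $(\Delta\otimes\mathrm{Id})(\mathcal{R})=\mathcal{R}_{13}\mathcal{R}_{23}$. An infinitesimal $\mathcal{R}$-matrix (pre-Cartier structure) for $(H,\mathcal{R})$ is $\chi\in H\otimes H$ such that $\chi\Delta(h)=\Delta(h)\chi$ for all $h\in H$, $(\mathrm{Id}\otimes\Delta)(\chi)=\chi_{12}+\mathcal{R}_{12}^{-1}\chi_{13}\mathcal{R}_{12}$, and $(\Delta\otimes\mathrm{Id})(\chi)=\chi_{23}+\mathcal{R}_{23}^{-1}\chi_{13}\mathcal{R}_{23}$. The trivial topological bialgebra $H[[\hbar]]$ is the space of formal power series in $\hbar$ with coefficients in $H$, with the $\hbar$-linear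 extension of the bialgebra structure of $H$, where the tensor product is replaced by its topological completion, so that $H[[\hbar]]\hat\otimes H[[\hbar]]\cong(H\otimes H)[[\hbar]]$ (and similarly for three factors). A quasitriangular structure on $H[[\hbar]]$ is an invertible $\tilde{\mathcal{R}}\in(H\otimes H)[[\hbar]]$ satisfying the same three axioms. Here $\exp(\hbar\chi)$ is the exponential series $\sum_k\frac{\hbar^k}{k!}\chi^k$, which is the displayed finite sum because $\chi^{n+1}=0$.
   Formalization: The formal theorem additionally assumes that n! is nonzero in the field (characteristic 0 or greater than n), since for 2 < char ≤ n the displayed term ħ^n/n! χ^n is undefined. *)

theory Defs
  imports
    "HOL-Library.Cardinality"
    "HOL-Computational_Algebra.Formal_Power_Series"
    "Jordan_Normal_Form.Determinant"
begin

section \<open>Algebras with a finite basis\<close>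

text \<open>\<open>sc a b c\<close> is the coefficient of the basis vector \<open>c\<close> in the product of the basis vectors
  \<open>a\<close> and \<open>b\<close>; the unit of the algebra is the basis vector \<open>ub\<close>.  For two such bases, the product type
  is the basis of the tensor product algebra.\<close>

class alg_basis = finite +
  fixes sc :: "'a \<Rightarrow> 'a \<Rightarrow> 'a \<Rightarrow> int"
    and ub :: 'a
  assumes sc_assoc: "(\<Sum>d\<in>UNIV. sc a b d * sc d c z) = (\<Sum>d\<in>UNIV. sc b c d * sc a d z)"
    and sc_ub_left: "sc ub a c = (if a = c then 1 else 0)"
    and sc_ub_right: "sc a ub c = (if a = c then 1 else 0)"

instantiation prod :: (alg_basis, alg_basis) alg_basis
begin

definition sc_prod :: "'a \<times> 'b \<Rightarrow> 'a \<times> 'b \<Rightarrow> 'a \<times> 'b \<Rightarrow> int" where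
  "sc_prod a b c = sc (fst a) (fst b) (fst c) * sc (snd a) (snd b) (snd c)"

definition ub_prod :: "'a \<times> 'b" where
  "ub_prod = (ub, ub)"

instance
proof
  fix a b c z :: "'a \<times> 'b"
  have *: "(\<Sum>d\<in>UNIV. f (fst d) * g (snd d)) = (\<Sum>d\<in>UNIV. f d) * (\<Sum>d\<in>UNIV. g d)"
    for f :: "'a \<Rightarrow> int" and g :: "'b \<Rightarrow> int"
    by (simp add: sum_product sum.cartesian_product UNIV_Times_UNIV[symmetric] case_prod_unfold
        del: UNIV_Times_UNIV)
  have "(\<Sum>d\<in>UNIV. sc a b d * sc d c z) =
      (\<Sum>d\<in>UNIV. sc (fst a) (fst b) d * sc d (fst c) (fst z)) *
      (\<Sum>d\<in>UNIV. sc (snd a) (snd b) d * sc d (snd c) (snd z))"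
    by (subst *[symmetric]) (simp add: sc_prod_def mult_ac)
  also have "\<dots> = (\<Sum>d\<in>UNIV. sc (fst b) (fst c) d * sc (fst a) d (fst z)) *
      (\<Sum>d\<in>UNIV. sc (snd b) (snd c) d * sc (snd a) d (snd z))"
    by (simp only: sc_assoc)
  also have "\<dots> = (\<Sum>d\<in>UNIV. sc b c d * sc a d z)"
    by (subst *[symmetric]) (simp add: sc_prod_def mult_ac)
  finally show "(\<Sum>d\<in>UNIV. sc a b d * sc d c z) = (\<Sum>d\<in>UNIV. sc b c d * sc a d z)" .
qed (auto simp: sc_prod_def ub_prod_def sc_ub_left sc_ub_right prod_eq_iff)

end

typedef ('k, 'b) alg = "UNIV :: ('b \<Rightarrow> 'k) set"
  morphisms coord Alg ..

lemma coord_Alg [simp]: "coord (Alg f) = f"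
  by (simp add: Alg_inverse)

lemma alg_eqI: "(\<And>b. coord u b = coord v b) \<Longrightarrow> u = v"
  by (metis coord_inject ext)

instantiation alg :: (comm_ring_1, alg_basis) ring_1
begin

definition "0 = Alg (\<lambda>_. 0)"
definition "1 = Alg (\<lambda>b. if b = ub then 1 else 0)"
definition "u + v = Alg (\<lambda>b. coord u b + coord v b)"
definition "u - v = Alg (\<lambda>b. coord u b - coord v b)"
definition "- u = Alg (\<lambda>b. - coord u b)"
definition "u * v =
  Alg (\<lambda>c. \<Sum>a\<in>UNIV. \<Sum>b\<in>UNIV. coord u a * coord v b * of_int (sc a b c))"

instance
proof
  fix u v w :: "('a, 'b) alg"
  show "u * v * w = u * (v * w)"
  proof (rule alg_eqI)
    fix z
    have "coord (u * v * w) z = (\<Sum>d\<in>UNIV. \<Sum>c\<in>UNIV. \<Sum>a\<in>UNIV. \<Sum>b\<in>UNIV.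
        coord u a * coord v b * coord w c * of_int (sc a b d * sc d c z))"
      by (simp add: times_alg_def sum_distrib_right sum_distrib_left mult_ac)
    also have "\<dots> = (\<Sum>c\<in>UNIV. \<Sum>d\<in>UNIV. \<Sum>a\<in>UNIV. \<Sum>b\<in>UNIV.
        coord u a * coord v b * coord w c * of_int (sc a b d * sc d c z))"
      by (rule sum.swap)
    also have "\<dots> = (\<Sum>c\<in>UNIV. \<Sum>a\<in>UNIV. \<Sum>d\<in>UNIV. \<Sum>b\<in>UNIV.
        coord u a * coord v b * coord w c * of_int (sc a b d * sc d c z))"
      by (intro sum.cong refl sum.swap)
    also have "\<dots> = (\<Sum>c\<in>UNIV. \<Sum>a\<in>UNIV. \<Sum>b\<in>UNIV. \<Sum>d\<in>UNIV.
        coord u a * coord v b * coord w c * of_int (sc a b d * sc d c z))"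
      by (intro sum.cong refl sum.swap)
    also have "\<dots> = (\<Sum>c\<in>UNIV. \<Sum>a\<in>UNIV. \<Sum>b\<in>UNIV.
        coord u a * coord v b * coord w c * of_int (\<Sum>d\<in>UNIV. sc a b d * sc d c z))"
      by (simp only: of_int_sum sum_distrib_left)
    also have "\<dots> = (\<Sum>c\<in>UNIV. \<Sum>a\<in>UNIV. \<Sum>b\<in>UNIV.
        coord u a * coord v b * coord w c * of_int (\<Sum>d\<in>UNIV. sc b c d * sc a d z))"
      by (simp only: sc_assoc)
    also have "\<dots> = (\<Sum>a\<in>UNIV. \<Sum>c\<in>UNIV. \<Sum>b\<in>UNIV.
        coord u a * coord v b * coord w c * of_int (\<Sum>d\<in>UNIV. sc b c d * sc a d z))"
      by (rule sum.swap)
    also have "\<dots> = (\<Sum>a\<in>UNIV. \<Sum>b\<in>UNIV. \<Sum>c\<in>UNIV.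
        coord u a * coord v b * coord w c * of_int (\<Sum>d\<in>UNIV. sc b c d * sc a d z))"
      by (intro sum.cong refl sum.swap)
    also have "\<dots> = (\<Sum>a\<in>UNIV. \<Sum>b\<in>UNIV. \<Sum>c\<in>UNIV. \<Sum>d\<in>UNIV.
        coord u a * coord v b * coord w c * of_int (sc b c d * sc a d z))"
      by (simp only: of_int_sum sum_distrib_left)
    also have "\<dots> = (\<Sum>a\<in>UNIV. \<Sum>b\<in>UNIV. \<Sum>d\<in>UNIV. \<Sum>c\<in>UNIV.
        coord u a * coord v b * coord w c * of_int (sc b c d * sc a d z))"
      by (intro sum.cong refl sum.swap)
    also have "\<dots> = (\<Sum>a\<in>UNIV. \<Sum>d\<in>UNIV. \<Sum>b\<in>UNIV. \<Sum>c\<in>UNIV.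
        coord u a * coord v b * coord w c * of_int (sc b c d * sc a d z))"
      by (intro sum.cong refl sum.swap)
    also have "\<dots> = coord (u * (v * w)) z"
      by (simp add: times_alg_def sum_distrib_right sum_distrib_left mult_ac)
    finally show "coord (u * v * w) z = coord (u * (v * w)) z" .
  qed
  have if_sum: "(\<Sum>b\<in>UNIV. if P then f b else 0) = (if P then \<Sum>b\<in>UNIV. f b else 0)"
    for P and f :: "'b \<Rightarrow> 'a" by simp
  show "1 * u = u"
    by (rule alg_eqI)
      (simp add: times_alg_def one_alg_def sc_ub_left if_distrib[of of_int] if_sum
        if_distrib[of "\<lambda>x. x * _"] if_distrib[of "\<lambda>x. _ * x"] cong: if_cong)
  show "u * 1 = u"
    by (rule alg_eqI)
      (simp add: times_alg_def one_alg_def sc_ub_right if_distrib[of of_int]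
        if_distrib[of "\<lambda>x. x * _"] if_distrib[of "\<lambda>x. _ * x"] cong: if_cong)
  show "(u + v) * w = u * w + v * w"
    by (rule alg_eqI) (simp add: times_alg_def plus_alg_def distrib_right sum.distrib)
  show "u * (v + w) = u * v + u * w"
    by (rule alg_eqI) (simp add: times_alg_def plus_alg_def distrib_left distrib_right sum.distrib)
  show "(0::('a, 'b) alg) \<noteq> 1"
  proof
    assume "(0::('a, 'b) alg) = 1"
    then have "coord (0::('a, 'b) alg) ub = coord (1::('a, 'b) alg) ub" by simp
    then show False by (simp add: zero_alg_def one_alg_def)
  qed
qed (rule alg_eqI; simp add: plus_alg_def zero_alg_def minus_alg_def uminus_alg_def)+

end

definition scl :: "'k::comm_ring_1 \<Rightarrow> ('k, 'b) alg \<Rightarrow> ('k, 'b) alg"  (infixr "*\<^sub>k" 75) where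
  "c *\<^sub>k u = Alg (\<lambda>b. c * coord u b)"

definition bvec :: "'b \<Rightarrow> ('k::comm_ring_1, 'b) alg" where
  "bvec b = Alg (\<lambda>c. if c = b then 1 else 0)"

definition lin_ext :: "('b \<Rightarrow> ('k, 'c) alg) \<Rightarrow>
    ('k::comm_ring_1, 'b::finite) alg \<Rightarrow> ('k, 'c::alg_basis) alg" where
  "lin_ext f u = (\<Sum>b\<in>UNIV. coord u b *\<^sub>k f b)"

definition tensor :: "('k::comm_ring_1, 'b) alg \<Rightarrow> ('k, 'c) alg \<Rightarrow> ('k, 'b \<times> 'c) alg"
    (infixr "\<boxtimes>" 68) where
  "u \<boxtimes> v = Alg (\<lambda>(b, c). coord u b * coord v c)"

lemmas coord_simps =
  zero_alg_def one_alg_def plus_alg_def minus_alg_def uminus_alg_def scl_def bvec_def tensor_def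

lemma coord_sum: "coord (sum f A) b = (\<Sum>a\<in>A. coord (f a :: ('k::comm_ring_1, 'b::alg_basis) alg) b)"
  by (induction A rule: infinite_finite_induct) (simp_all add: coord_simps)

lemma vector_space_scl:
  "vector_space ((*\<^sub>k) :: 'k::field \<Rightarrow> ('k, 'b::alg_basis) alg \<Rightarrow> ('k, 'b) alg)"
  by unfold_locales (rule alg_eqI; simp add: coord_simps algebra_simps)+

lemma scl_mult_left: "(c *\<^sub>k u) * v = c *\<^sub>k (u * v)"
  for u v :: "('k::comm_ring_1, 'b::alg_basis) alg"
  by (rule alg_eqI) (simp add: times_alg_def scl_def sum_distrib_left mult_ac)

lemma scl_mult_right: "u * (c *\<^sub>k v) = c *\<^sub>k (u * v)"
  for u v :: "('k::comm_ring_1, 'b::alg_basis) alg"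
  by (rule alg_eqI) (simp add: times_alg_def scl_def sum_distrib_left mult_ac)

lemma scl_scl: "c *\<^sub>k d *\<^sub>k u = (c * d) *\<^sub>k u"
  by (rule alg_eqI) (simp add: scl_def mult_ac)

lemma bvec_expand: "u = (\<Sum>b\<in>UNIV. coord u b *\<^sub>k bvec b)"
  for u :: "('k::comm_ring_1, 'b::alg_basis) alg"
  by (rule alg_eqI)
    (simp add: coord_sum coord_simps if_distrib[of "\<lambda>x. _ * x"] cong: if_cong)

lemma tensor_mult: "(u \<boxtimes> v) * (u' \<boxtimes> v') = (u * u') \<boxtimes> (v * v')"
  for u u' :: "('k::comm_ring_1, 'b::alg_basis) alg" and v v' :: "('k, 'c::alg_basis) alg"
proof (rule alg_eqI)
  fix z :: "'b \<times> 'c"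
  obtain x y where z: "z = (x, y)" by (cases z)
  have "coord ((u \<boxtimes> v) * (u' \<boxtimes> v')) z =
      (\<Sum>(a, c)\<in>UNIV \<times> UNIV. \<Sum>(b, d)\<in>UNIV \<times> UNIV. (coord u a * coord v c) *
         (coord u' b * coord v' d) * (of_int (sc a b x) * of_int (sc c d y)))"
    by (simp add: times_alg_def tensor_def sc_prod_def z case_prod_unfold)
  also have "\<dots> = (\<Sum>a\<in>UNIV. \<Sum>c\<in>UNIV. \<Sum>b\<in>UNIV. \<Sum>d\<in>UNIV. (coord u a * coord v c) *
         (coord u' b * coord v' d) * (of_int (sc a b x) * of_int (sc c d y)))"
    by (simp only: sum.cartesian_product[symmetric])
  also have "\<dots> = (\<Sum>a\<in>UNIV. \<Sum>b\<in>UNIV. \<Sum>c\<in>UNIV. \<Sum>d\<in>UNIV. (coord u a * coord v c) *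
         (coord u' b * coord v' d) * (of_int (sc a b x) * of_int (sc c d y)))"
    by (intro sum.cong refl sum.swap)
  also have "\<dots> = (\<Sum>a\<in>UNIV. \<Sum>b\<in>UNIV. coord u a * coord u' b * of_int (sc a b x)) *
      (\<Sum>c\<in>UNIV. \<Sum>d\<in>UNIV. coord v c * coord v' d * of_int (sc c d y))"
    by (simp only: sum_distrib_right, simp only: sum_distrib_left mult_ac)
  also have "\<dots> = coord ((u * u') \<boxtimes> (v * v')) z"
    by (simp add: times_alg_def tensor_def z)
  finally show "coord ((u \<boxtimes> v) * (u' \<boxtimes> v')) z = coord ((u * u') \<boxtimes> (v * v')) z" .
qed


section \<open>Maps between tensor powers\<close>

text \<open>\<open>tensor_map f g\<close> is \<open>f \<otimes> g\<close> for linear \<open>f\<close> and \<open>g\<close>.  Triple tensor products are nested to the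
  right.\<close>

definition tensor_map ::
  "(('k::comm_ring_1, 'a::alg_basis) alg \<Rightarrow> ('k, 'c::alg_basis) alg) \<Rightarrow>
   (('k, 'b::alg_basis) alg \<Rightarrow> ('k, 'd::alg_basis) alg) \<Rightarrow>
   ('k, 'a \<times> 'b) alg \<Rightarrow> ('k, 'c \<times> 'd) alg" where
  "tensor_map f g = lin_ext (\<lambda>(a, b). f (bvec a) \<boxtimes> g (bvec b))"

definition assoc_tensor ::
  "('k, ('a \<times> 'b) \<times> 'c) alg \<Rightarrow> ('k::comm_ring_1, 'a \<times> 'b \<times> 'c) alg" where
  "assoc_tensor T = Alg (\<lambda>(a, b, c). coord T ((a, b), c))"

definition flip :: "('k, 'a \<times> 'b) alg \<Rightarrow> ('k::comm_ring_1, 'b \<times> 'a) alg" where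
  "flip T = Alg (\<lambda>(b, a). coord T (a, b))"

definition id_tensor ::
  "(('k, 'b) alg \<Rightarrow> ('k, 'b \<times> 'b) alg) \<Rightarrow>
   ('k, 'b \<times> 'b) alg \<Rightarrow> ('k::comm_ring_1, 'b::alg_basis \<times> 'b \<times> 'b) alg" where
  "id_tensor \<Delta> = tensor_map id \<Delta>"

definition tensor_id ::
  "(('k, 'b) alg \<Rightarrow> ('k, 'b \<times> 'b) alg) \<Rightarrow>
   ('k, 'b \<times> 'b) alg \<Rightarrow> ('k::comm_ring_1, 'b::alg_basis \<times> 'b \<times> 'b) alg" where
  "tensor_id \<Delta> T = assoc_tensor (tensor_map \<Delta> id T)"

definition leg12 :: "('k, 'b \<times> 'b) alg \<Rightarrow> ('k::comm_ring_1, 'b::alg_basis \<times> 'b \<times> 'b) alg" where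
  "leg12 T = assoc_tensor (T \<boxtimes> 1)"

definition leg23 :: "('k, 'b \<times> 'b) alg \<Rightarrow> ('k::comm_ring_1, 'b::alg_basis \<times> 'b \<times> 'b) alg" where
  "leg23 T = 1 \<boxtimes> T"

definition leg13 :: "('k, 'b \<times> 'b) alg \<Rightarrow> ('k::comm_ring_1, 'b::alg_basis \<times> 'b \<times> 'b) alg" where
  "leg13 = lin_ext (\<lambda>(a, b). bvec a \<boxtimes> 1 \<boxtimes> bvec b)"


section \<open>Quasitriangular and pre-Cartier structures\<close>

definition mult_invertible :: "'a::monoid_mult \<Rightarrow> bool" where
  "mult_invertible a \<longleftrightarrow> (\<exists>b. a * b = 1 \<and> b * a = 1)"

definition mult_inv :: "'a::monoid_mult \<Rightarrow> 'a" where
  "mult_inv a = (THE b. a * b = 1 \<and> b * a = 1)"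

lemma mult_inv:
  assumes "mult_invertible a"
  shows "a * mult_inv a = 1" and "mult_inv a * a = 1"
proof -
  from assms obtain b where b: "a * b = 1 \<and> b * a = 1"
    by (auto simp: mult_invertible_def)
  have "mult_inv a = b"
    unfolding mult_inv_def using b by (rule the_equality) (metis b mult.assoc mult_1_left mult_1_right)
  with b show "a * mult_inv a = 1" "mult_inv a * a = 1" by auto
qed

text \<open>The arguments are the maps \<open>\<Delta>\<close>, flip, \<open>Id \<otimes> \<Delta>\<close>, \<open>\<Delta> \<otimes> Id\<close> and
  \<open>T \<mapsto> T\<^sub>1\<^sub>2\<close>, \<open>T \<mapsto> T\<^sub>1\<^sub>3\<close>, \<open>T \<mapsto> T\<^sub>2\<^sub>3\<close>, so that the same
  axioms apply to a bialgebra and to its topological version over formal power series.\<close>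

definition R_matrix_axioms ::
  "('h \<Rightarrow> 'h2::monoid_mult) \<Rightarrow> ('h2 \<Rightarrow> 'h2) \<Rightarrow> ('h2 \<Rightarrow> 'h3) \<Rightarrow> ('h2 \<Rightarrow> 'h3) \<Rightarrow>
   ('h2 \<Rightarrow> 'h3) \<Rightarrow> ('h2 \<Rightarrow> 'h3) \<Rightarrow> ('h2 \<Rightarrow> 'h3::monoid_mult) \<Rightarrow> 'h2 \<Rightarrow> bool" where
  "R_matrix_axioms \<Delta> \<tau> id\<Delta> \<Delta>id i12 i13 i23 R \<longleftrightarrow>
     mult_invertible R \<and>
     (\<forall>h. \<tau> (\<Delta> h) = R * \<Delta> h * mult_inv R) \<and>
     id\<Delta> R = i13 R * i12 R \<and>
     \<Delta>id R = i13 R * i23 R"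

definition quasitriangular ::
  "(('k::comm_ring_1, 'b::alg_basis) alg \<Rightarrow> ('k, 'b \<times> 'b) alg) \<Rightarrow> ('k, 'b \<times> 'b) alg \<Rightarrow> bool" where
  "quasitriangular \<Delta> R \<longleftrightarrow>
     R_matrix_axioms \<Delta> flip (id_tensor \<Delta>) (tensor_id \<Delta>) leg12 leg13 leg23 R"

definition infinitesimal_R_matrix ::
  "(('k::comm_ring_1, 'b::alg_basis) alg \<Rightarrow> ('k, 'b \<times> 'b) alg) \<Rightarrow>
   ('k, 'b \<times> 'b) alg \<Rightarrow> ('k, 'b \<times> 'b) alg \<Rightarrow> bool" where
  "infinitesimal_R_matrix \<Delta> R \<chi> \<longleftrightarrow>
     (\<forall>h. \<chi> * \<Delta> h = \<Delta> h * \<chi>) \<and>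
     id_tensor \<Delta> \<chi> = leg12 \<chi> + mult_inv (leg12 R) * leg13 \<chi> * leg12 R \<and>
     tensor_id \<Delta> \<chi> = leg23 \<chi> + mult_inv (leg23 R) * leg13 \<chi> * leg23 R"

definition fps_map :: "('a \<Rightarrow> 'b) \<Rightarrow> 'a fps \<Rightarrow> 'b fps" where
  "fps_map f F = Abs_fps (\<lambda>k. f (fps_nth F k))"

text \<open>The topological tensor powers of \<open>H[[\<hbar>]]\<close> are identified with \<open>(H \<otimes> H)[[\<hbar>]]\<close> and
  \<open>(H \<otimes> H \<otimes> H)[[\<hbar>]]\<close>; the \<open>\<hbar>\<close>-linear extension of a linear map acts on coefficients.\<close>

definition quasitriangular_fps ::
  "(('k::comm_ring_1, 'b::alg_basis) alg \<Rightarrow> ('k, 'b \<times> 'b) alg) \<Rightarrow> ('k, 'b \<times> 'b) alg fps \<Rightarrow> bool" where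
  "quasitriangular_fps \<Delta> R \<longleftrightarrow>
     R_matrix_axioms (fps_map \<Delta>) (fps_map flip) (fps_map (id_tensor \<Delta>)) (fps_map (tensor_id \<Delta>))
       (fps_map leg12) (fps_map leg13) (fps_map leg23) R"

text \<open>In positive characteristic \<open>1 / k!\<close> is the junk value \<open>0\<close> once \<open>k! = 0\<close>; the series
  is meaningful if \<open>u\<^sup>n\<^sup>+\<^sup>1 = 0\<close> and \<open>n! \<noteq> 0\<close>.\<close>

definition exp_hbar :: "('k::field, 'b::alg_basis) alg \<Rightarrow> ('k, 'b) alg fps" where
  "exp_hbar u = Abs_fps (\<lambda>k. (1 / of_nat (fact k)) *\<^sub>k u ^ k)"


section \<open>The Hopf algebra \<open>E(n)\<close>\<close>

text \<open>The index type \<open>'n\<close> plays the role of \<open>{1,\<dots>,n}\<close>, with \<open>n = CARD('n)\<close>.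
  The basis vector \<open>Gx a P\<close> stands for \<open>g\<^sup>a x\<^sub>P\<close>, and
  \<open>g\<^sup>a x\<^sub>P g\<^sup>b x\<^sub>Q = mono_sgn \<cdot> g\<^sup>a\<^sup>+\<^sup>b x\<^bsub>P \<union> Q\<^esub>\<close>: the sign counts the transpositions needed to move
  \<open>g\<^sup>b\<close> past \<open>x\<^sub>P\<close> and to sort the concatenation of \<open>P\<close> and \<open>Q\<close>.\<close>

datatype 'n mono = Gx bool "'n set"

fun mono_mul :: "'n mono \<Rightarrow> 'n mono \<Rightarrow> 'n mono" where
  "mono_mul (Gx a P) (Gx b Q) = Gx (a \<noteq> b) (P \<union> Q)"

definition inversions :: "'n::linorder set \<Rightarrow> 'n set \<Rightarrow> nat" where
  "inversions P Q = card {(p, q). p \<in> P \<and> q \<in> Q \<and> q < p}"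

fun mono_sgn :: "'n::linorder mono \<Rightarrow> 'n mono \<Rightarrow> int" where
  "mono_sgn (Gx a P) (Gx b Q) =
     (if P \<inter> Q = {} then (-1) ^ (of_bool b * card P + inversions P Q) else 0)"

lemma inversions_Un_left:
  fixes P Q R :: "'n::{finite, linorder} set"
  assumes "P \<inter> Q = {}"
  shows "inversions (P \<union> Q) R = inversions P R + inversions Q R"
proof -
  have "{(p, q). p \<in> P \<union> Q \<and> q \<in> R \<and> q < p} =
      {(p, q). p \<in> P \<and> q \<in> R \<and> q < p} \<union> {(p, q). p \<in> Q \<and> q \<in> R \<and> q < p}" by auto
  then show ?thesis
    unfolding inversions_def using assms by (simp add: card_Un_disjoint disjoint_iff)
qed

lemma inversions_Un_right:
  fixes P Q R :: "'n::{finite, linorder} set"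
  assumes "Q \<inter> R = {}"
  shows "inversions P (Q \<union> R) = inversions P Q + inversions P R"
proof -
  have "{(p, q). p \<in> P \<and> q \<in> Q \<union> R \<and> q < p} =
      {(p, q). p \<in> P \<and> q \<in> Q \<and> q < p} \<union> {(p, q). p \<in> P \<and> q \<in> R \<and> q < p}" by auto
  then show ?thesis
    unfolding inversions_def using assms by (simp add: card_Un_disjoint disjoint_iff)
qed

lemma inversions_empty [simp]: "inversions {} Q = 0" "inversions P {} = 0"
  by (simp_all add: inversions_def)

lemma mono_mul_assoc: "mono_mul (mono_mul a b) c = mono_mul a (mono_mul b c)"
  by (cases a; cases b; cases c) auto

lemma mono_sgn_assoc:
  fixes a b c :: "'n::{finite, linorder} mono"
  shows "mono_sgn a b * mono_sgn (mono_mul a b) c = mono_sgn b c * mono_sgn a (mono_mul b c)"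
proof (cases a; cases b; cases c)
  fix s t u and P Q R :: "'n set"
  assume abc: "a = Gx s P" "b = Gx t Q" "c = Gx u R"
  show ?thesis
  proof (cases "P \<inter> Q = {} \<and> P \<inter> R = {} \<and> Q \<inter> R = {}")
    case True
    then have d: "P \<inter> Q = {}" "P \<inter> R = {}" "Q \<inter> R = {}"
      and d': "(P \<union> Q) \<inter> R = {}" "P \<inter> (Q \<union> R) = {}"
      by auto
    then show ?thesis
      unfolding abc
      by (cases t; cases u)
        (simp_all add: inversions_Un_left inversions_Un_right card_Un_disjoint power_add)
  next
    case False
    then show ?thesis
      unfolding abc by auto
  qed
qed

instance mono :: (finite) finite
proof
  have "range (case_prod Gx) = (UNIV :: 'a mono set)"
    by (auto simp: image_iff) (metis mono.exhaust)
  then show "finite (UNIV :: 'a mono set)"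
    using finite_imageI[of "UNIV :: (bool \<times> 'a set) set" "case_prod Gx"] by simp
qed

instantiation mono :: ("{finite, linorder}") alg_basis
begin

definition sc_mono :: "'a mono \<Rightarrow> 'a mono \<Rightarrow> 'a mono \<Rightarrow> int" where
  "sc_mono a b c = (if c = mono_mul a b then mono_sgn a b else 0)"

definition ub_mono :: "'a mono" where
  "ub_mono = Gx False {}"

instance
proof
  fix a b c z :: "'a mono"
  have "(\<Sum>d\<in>UNIV. sc a b d * sc d c z) = mono_sgn a b * sc (mono_mul a b) c z"
    by (simp add: sc_mono_def if_distrib[of "\<lambda>x. x * _"] cong: if_cong)
  moreover have "(\<Sum>d\<in>UNIV. sc b c d * sc a d z) = mono_sgn b c * sc a (mono_mul b c) z"
    by (simp add: sc_mono_def if_distrib[of "\<lambda>x. x * _"] cong: if_cong)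
  ultimately show "(\<Sum>d\<in>UNIV. sc a b d * sc d c z) = (\<Sum>d\<in>UNIV. sc b c d * sc a d z)"
    by (simp add: sc_mono_def mono_mul_assoc mono_sgn_assoc)
next
  fix a c :: "'a mono"
  show "sc ub a c = (if a = c then 1 else 0)" "sc a ub c = (if a = c then 1 else 0)"
    by (cases a; auto simp: sc_mono_def ub_mono_def)+
qed

end


definition gen_g :: "('k::comm_ring_1, 'n::{finite, linorder} mono) alg" where
  "gen_g = bvec (Gx True {})"

definition gen_x :: "'n \<Rightarrow> ('k::comm_ring_1, 'n::{finite, linorder} mono) alg" where
  "gen_x i = bvec (Gx False {i})"

definition xprod :: "'n set \<Rightarrow> ('k::comm_ring_1, 'n::{finite, linorder} mono) alg" where
  "xprod P = prod_list (map gen_x (sorted_list_of_set P))"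

lemma bvec_mult:
  "bvec a * bvec b = (of_int (mono_sgn a b) *\<^sub>k bvec (mono_mul a b) :: ('k::comm_ring_1, _) alg)"
  for a b :: "'n::{finite, linorder} mono"
proof (rule alg_eqI)
  fix c
  have if_sum: "(\<Sum>b\<in>UNIV. if P then f b else 0) = (if P then \<Sum>b\<in>UNIV. f b else 0)"
    for P and f :: "'n mono \<Rightarrow> 'k" by simp
  have "coord (bvec a * bvec b :: ('k, 'n mono) alg) c = of_int (sc a b c)"
    by (simp add: times_alg_def bvec_def if_sum if_distrib[of "\<lambda>x. x * _"] cong: if_cong)
  then show "coord (bvec a * bvec b) c = coord (of_int (mono_sgn a b) *\<^sub>k bvec (mono_mul a b) :: ('k, 'n mono) alg) c"
    by (simp add: bvec_def scl_def sc_mono_def)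
qed

lemma bvec_unit: "bvec (Gx False {}) = 1"
  by (simp add: bvec_def one_alg_def ub_mono_def)

lemma scl_simps: "1 *\<^sub>k u = u" "0 *\<^sub>k u = 0" "(- 1) *\<^sub>k u = - u"
  for u :: "('k::comm_ring_1, 'b::alg_basis) alg"
  by (rule alg_eqI; simp add: coord_simps)+

lemma scl_of_int: "of_int z *\<^sub>k u = of_int z * u"
  for u :: "('k::comm_ring_1, 'b::alg_basis) alg"
proof -
  have add: "(c + d) *\<^sub>k u = c *\<^sub>k u + d *\<^sub>k u" for c d :: 'k
    by (rule alg_eqI) (simp add: coord_simps distrib_right)
  have diff: "(c - d) *\<^sub>k u = c *\<^sub>k u - d *\<^sub>k u" for c d :: 'k
    by (rule alg_eqI) (simp add: coord_simps left_diff_distrib)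
  show ?thesis
    by (induction z rule: int_induct[where k = 0])
      (simp_all add: add diff scl_simps distrib_right left_diff_distrib)
qed

lemma E_relations:
  fixes i j :: "'n::{finite, linorder}"
  shows "(gen_g :: ('k::comm_ring_1, 'n mono) alg) * gen_g = 1"
    and "(gen_x i :: ('k::comm_ring_1, 'n mono) alg) * gen_x i = 0"
    and "(gen_g :: ('k::comm_ring_1, 'n mono) alg) * gen_x i = - (gen_x i * gen_g)"
    and "(gen_x i :: ('k::comm_ring_1, 'n mono) alg) * gen_x j = - (gen_x j * gen_x i)"
proof -
  have inv: "inversions {i} {j} = of_bool (j < i)" for i j :: 'n
  proof -
    have "{(p, q). p \<in> {i} \<and> q \<in> {j} \<and> q < p} = (if j < i then {(i, j)} else {})" by auto
    then show ?thesis by (simp add: inversions_def)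
  qed
  show "(gen_g :: ('k, 'n mono) alg) * gen_g = 1"
    by (simp add: gen_g_def bvec_mult bvec_unit scl_simps)
  show sq: "(gen_x i :: ('k, 'n mono) alg) * gen_x i = 0" for i
    by (simp add: gen_x_def bvec_mult scl_simps)
  show "(gen_g :: ('k, 'n mono) alg) * gen_x i = - (gen_x i * gen_g)"
    by (simp add: gen_g_def gen_x_def bvec_mult scl_simps)
  show "(gen_x i :: ('k, 'n mono) alg) * gen_x j = - (gen_x j * gen_x i)"
  proof (cases i j rule: linorder_cases)
    case equal
    then show ?thesis using sq by simp
  qed (auto simp: gen_x_def bvec_mult inv scl_simps insert_commute)
qed

text \<open>Extension of an assignment of the generators to the monomials \<open>g\<^sup>a x\<^sub>P\<close>; its linear extension is an
  algebra map as soon as the relations of \<open>E(n)\<close> hold, i.e. \<open>E(n)\<close> is presented by these relations.\<close>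

fun mono_eval :: "'a::monoid_mult \<Rightarrow> ('n::{finite, linorder} \<Rightarrow> 'a) \<Rightarrow> 'n mono \<Rightarrow> 'a" where
  "mono_eval G X (Gx a P) = (if a then G else 1) * prod_list (map X (sorted_list_of_set P))"

context
  fixes G :: "'a::ring_1" and X :: "'n::{finite, linorder} \<Rightarrow> 'a"
  assumes GG: "G * G = 1" and XX: "\<And>i. X i * X i = 0"
    and GX: "\<And>i. G * X i = - (X i * G)" and XY: "\<And>i j. X i * X j = - (X j * X i)"
begin

lemma prod_X_G: "prod_list (map X is) * G = (- 1) ^ length is * (G * prod_list (map X is))"
proof (induction "is")
  case (Cons i js)
  have "prod_list (map X (i # js)) * G = X i * (prod_list (map X js) * G)"
    by (simp add: mult.assoc)
  also have "\<dots> = X i * ((- 1) ^ length js * (G * prod_list (map X js)))"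
    by (simp only: Cons)
  also have "\<dots> = (- 1) ^ length js * ((X i * G) * prod_list (map X js))"
    by (cases "even (length js)") (simp_all add: mult.assoc)
  also have "X i * G = - (G * X i)" by (simp add: GX)
  finally show ?case by (simp add: mult.assoc)
qed simp

lemma X_prod:
  assumes "sorted is" "distinct is"
  shows "X i * prod_list (map X is) = (if i \<in> set is then 0
    else (- 1) ^ card {j \<in> set is. j < i} * prod_list (map X (insort i is)))"
  using assms
proof (induction "is")
  case (Cons j js)
  consider "i < j" | "i = j" | "j < i" by (rule linorder_cases)
  then show ?case
  proof cases
    case 1
    then have "{k \<in> set (j # js). k < i} = {}" "i \<notin> set (j # js)" using Cons.prems by auto
    then have "card {k \<in> set (j # js). k < i} = 0" "i \<notin> set (j # js)"
      by (simp_all only: card.empty simp_thms)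
    then show ?thesis using 1 by (simp only: if_False power_0) (simp add: less_imp_le)
  next
    case 2
    then show ?thesis by (simp add: mult.assoc[symmetric] XX)
  next
    case 3
    have IH: "X i * prod_list (map X js) = (if i \<in> set js then 0
      else (- 1) ^ card {k \<in> set js. k < i} * prod_list (map X (insort i js)))"
      using Cons by simp
    have "{k \<in> set (j # js). k < i} = insert j {k \<in> set js. k < i}" using 3 by auto
    then have c: "card {k \<in> set (j # js). k < i} = Suc (card {k \<in> set js. k < i})"
      using Cons.prems by simp
    have "X i * prod_list (map X (j # js)) = (X i * X j) * prod_list (map X js)"
      by (simp add: mult.assoc)
    also have "\<dots> = - (X j * (X i * prod_list (map X js)))"
      by (subst XY) (simp add: mult.assoc)
    also have "\<dots> = (if i \<in> set (j # js) then 0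
      else (- 1) ^ card {k \<in> set (j # js). k < i} * prod_list (map X (insort i (j # js))))"
      using 3 unfolding IH c
      by (cases "even (card {k \<in> set js. k < i})") (auto simp: mult.assoc)
    finally show ?thesis .
  qed
qed simp

lemma prod_X_prod_X:
  assumes "sorted ps" "distinct ps"
  shows "prod_list (map X ps) * prod_list (map X (sorted_list_of_set Q)) =
    (if set ps \<inter> Q = {} then (- 1) ^ inversions (set ps) Q *
       prod_list (map X (sorted_list_of_set (set ps \<union> Q))) else 0)"
  using assms
proof (induction ps)
  case (Cons p ps)
  then have p: "p \<notin> set ps" "\<And>q. q \<in> set ps \<Longrightarrow> p < q"
    by (auto simp: order.strict_iff_order)
  have IH: "prod_list (map X ps) * prod_list (map X (sorted_list_of_set Q)) =
    (if set ps \<inter> Q = {} then (- 1) ^ inversions (set ps) Q *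
       prod_list (map X (sorted_list_of_set (set ps \<union> Q))) else 0)"
    using Cons by simp
  have "{(p', q). p' \<in> {p} \<and> q \<in> Q \<and> q < p'} = Pair p ` {j \<in> set ps \<union> Q. j < p}"
    using p(2) by (auto dest: less_asym')
  then have ip: "inversions {p} Q = card {j \<in> set ps \<union> Q. j < p}"
    unfolding inversions_def by (simp add: card_image inj_on_def)
  have inv: "inversions (set (p # ps)) Q = inversions {p} Q + inversions (set ps) Q"
    using inversions_Un_left[of "{p}" "set ps" Q] p by simp
  have "prod_list (map X (p # ps)) * prod_list (map X (sorted_list_of_set Q)) =
    X p * (prod_list (map X ps) * prod_list (map X (sorted_list_of_set Q)))"
    by (simp add: mult.assoc)
  also have "\<dots> = (if set (p # ps) \<inter> Q = {} then (- 1) ^ inversions (set (p # ps)) Q *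
       prod_list (map X (sorted_list_of_set (set (p # ps) \<union> Q))) else 0)"
  proof (cases "set ps \<inter> Q = {}")
    case True
    have "X p * ((- 1) ^ inversions (set ps) Q * prod_list (map X (sorted_list_of_set (set ps \<union> Q)))) =
      (- 1) ^ inversions (set ps) Q * (X p * prod_list (map X (sorted_list_of_set (set ps \<union> Q))))"
      by (cases "even (inversions (set ps) Q)") simp_all
    also have "X p * prod_list (map X (sorted_list_of_set (set ps \<union> Q))) =
      (if p \<in> set ps \<union> Q then 0 else (- 1) ^ inversions {p} Q *
        prod_list (map X (insort p (sorted_list_of_set (set ps \<union> Q)))))"
      by (subst X_prod) (simp_all add: ip)
    finally show ?thesis
      unfolding IH inv using True p
      by (auto simp: power_add mult.assoc[symmetric] minus_one_power_iff)
  next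
    case False
    then have "\<not> set (p # ps) \<inter> Q = {}" by auto
    with False show ?thesis unfolding IH by simp
  qed
  finally show ?case .
qed simp

lemma mono_eval_mult:
  "mono_eval G X a * mono_eval G X b = of_int (mono_sgn a b) * mono_eval G X (mono_mul a b)"
proof (cases a; cases b)
  fix s t and P Q :: "'n set"
  assume ab: "a = Gx s P" "b = Gx t Q"
  define p where "p = prod_list (map X (sorted_list_of_set P))"
  define q where "q = prod_list (map X (sorted_list_of_set Q))"
  define r where "r = prod_list (map X (sorted_list_of_set (P \<union> Q)))"
  have pq: "p * q = (if P \<inter> Q = {} then (- 1) ^ inversions P Q * r else 0)"
    unfolding p_def q_def r_def using prod_X_prod_X[of "sorted_list_of_set P" Q] by simp
  have pG: "p * G = (- 1) ^ card P * (G * p)"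
    unfolding p_def using prod_X_G[of "sorted_list_of_set P"] by simp
  have "(if s then G else 1) * p * ((if t then G else 1) * q) =
      (- 1) ^ (of_bool t * card P) * ((if s then G else 1) * (if t then G else 1) * (p * q))"
  proof (cases t)
    case True
    have "(if s then G else 1) * p * (G * q) = (if s then G else 1) * (p * G) * q"
      by (simp add: mult.assoc)
    also have "\<dots> = (- 1) ^ card P * ((if s then G else 1) * G * (p * q))"
      unfolding pG by (cases "even (card P)") (simp_all add: mult.assoc)
    finally show ?thesis using True by simp
  qed (simp add: mult.assoc)
  moreover have "(if s then G else 1) * (if t then G else 1) = (if s \<noteq> t then G else 1)"
    using GG by simp
  ultimately have "mono_eval G X a * mono_eval G X b =
      (- 1) ^ (of_bool t * card P) * ((if s \<noteq> t then G else 1) * (p * q))"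
    by (simp add: ab p_def q_def)
  then show ?thesis
    unfolding pq
    by (auto simp: ab r_def power_add minus_one_power_iff)
qed

end

lemma mono_eval_gen: "mono_eval gen_g gen_x = (bvec :: _ \<Rightarrow> ('k::comm_ring_1, 'n::{finite, linorder} mono) alg)"
proof -
  have *: "prod_list (map gen_x ps) = (bvec (Gx False (set ps)) :: ('k, 'n mono) alg)"
    if "sorted ps" "distinct ps" for ps :: "'n list"
    using that
  proof (induction ps)
    case (Cons p ps)
    then have "{(p', q). p' \<in> {p} \<and> q \<in> set ps \<and> q < p'} = {}" by auto
    then have "inversions {p} (set ps) = 0" unfolding inversions_def by (simp only: card.empty)
    with Cons show ?case by (simp add: gen_x_def bvec_mult scl_simps)
  qed (simp add: bvec_unit)
  show ?thesis
  proof
    fix m :: "'n mono"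
    show "mono_eval gen_g gen_x m = (bvec m :: ('k, 'n mono) alg)"
      by (cases m) (simp add: * gen_g_def bvec_mult scl_simps)
  qed
qed

lemma bvec_Gx: "bvec (Gx a P) = (if a then gen_g else 1) * xprod P"
  for P :: "'n::{finite, linorder} set"
  by (simp add: mono_eval_gen[symmetric] xprod_def)

lemma lin_ext_mono_eval_mult:
  fixes G :: "('k::comm_ring_1, 'c::alg_basis) alg" and X :: "'n::{finite, linorder} \<Rightarrow> ('k, 'c) alg"
  assumes "G * G = 1" "\<And>i. X i * X i = 0" "\<And>i. G * X i = - (X i * G)"
    "\<And>i j. X i * X j = - (X j * X i)"
  shows "lin_ext (mono_eval G X) (u * v) = lin_ext (mono_eval G X) u * lin_ext (mono_eval G X) v"
proof -
  let ?f = "mono_eval G X"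
  have f: "?f a * ?f b = of_int (mono_sgn a b) *\<^sub>k ?f (mono_mul a b)" for a b
    using mono_eval_mult[OF assms] by (simp add: scl_of_int)
  have sum_scl: "(\<Sum>a\<in>A. h a) *\<^sub>k w = (\<Sum>a\<in>A. h a *\<^sub>k w)" for h :: "'d \<Rightarrow> 'k" and A and w :: "('k, 'c) alg"
    by (rule alg_eqI) (simp add: coord_sum scl_def sum_distrib_right)
  have "lin_ext ?f (u * v) = (\<Sum>c\<in>UNIV. \<Sum>a\<in>UNIV. \<Sum>b\<in>UNIV.
      (coord u a * coord v b * of_int (sc a b c)) *\<^sub>k ?f c)"
    by (simp add: lin_ext_def times_alg_def sum_scl)
  also have "\<dots> = (\<Sum>a\<in>UNIV. \<Sum>c\<in>UNIV. \<Sum>b\<in>UNIV.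
      (coord u a * coord v b * of_int (sc a b c)) *\<^sub>k ?f c)"
    by (rule sum.swap)
  also have "\<dots> = (\<Sum>a\<in>UNIV. \<Sum>b\<in>UNIV. \<Sum>c\<in>UNIV.
      (coord u a * coord v b * of_int (sc a b c)) *\<^sub>k ?f c)"
    by (intro sum.cong refl sum.swap)
  also have "\<dots> = (\<Sum>a\<in>UNIV. \<Sum>b\<in>UNIV. (coord u a * coord v b) *\<^sub>k (?f a * ?f b))"
  proof (intro sum.cong refl)
    fix a b :: "'n mono"
    have "(\<Sum>c\<in>UNIV. (coord u a * coord v b * of_int (sc a b c)) *\<^sub>k ?f c) =
      (\<Sum>c\<in>UNIV. if c = mono_mul a b then (coord u a * coord v b * of_int (mono_sgn a b)) *\<^sub>k ?f c else 0)"
      by (intro sum.cong refl) (simp add: sc_mono_def scl_simps)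
    then show "(\<Sum>c\<in>UNIV. (coord u a * coord v b * of_int (sc a b c)) *\<^sub>k ?f c) =
      (coord u a * coord v b) *\<^sub>k (?f a * ?f b)"
      by (simp add: f scl_scl)
  qed
  also have "\<dots> = lin_ext ?f u * lin_ext ?f v"
    by (simp add: lin_ext_def sum_product scl_mult_left scl_mult_right scl_scl mult_ac)
  finally show ?thesis .
qed

text \<open>The comultiplication is the algebra map with \<open>\<Delta>(g) = g \<otimes> g\<close> and
  \<open>\<Delta>(x\<^sub>i) = x\<^sub>i \<otimes> 1 + g \<otimes> x\<^sub>i\<close>.  Counit and antipode do not occur in the axioms for
  \<open>R\<close>-matrices and are omitted.\<close>

definition comult ::
  "('k::comm_ring_1, 'n::{finite, linorder} mono) alg \<Rightarrow> ('k, 'n mono \<times> 'n mono) alg" where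
  "comult = lin_ext (mono_eval (gen_g \<boxtimes> gen_g) (\<lambda>i. gen_x i \<boxtimes> 1 + gen_g \<boxtimes> gen_x i))"

lemma tensor_lin:
  fixes u u' :: "('k::comm_ring_1, 'b::alg_basis) alg" and v v' :: "('k, 'c::alg_basis) alg"
  shows "(u + u') \<boxtimes> v = u \<boxtimes> v + u' \<boxtimes> v" "u \<boxtimes> (v + v') = u \<boxtimes> v + u \<boxtimes> v'"
    "(- u) \<boxtimes> v = - (u \<boxtimes> v)" "u \<boxtimes> (- v) = - (u \<boxtimes> v)" "0 \<boxtimes> v = 0" "u \<boxtimes> 0 = 0"
    "(1 :: ('k, 'b) alg) \<boxtimes> (1 :: ('k, 'c) alg) = 1"
  by (rule alg_eqI; auto simp: coord_simps distrib_right distrib_left ub_prod_def split: prod.splits)+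

lemma comult_mult: "comult (u * v) = comult u * comult v"
  unfolding comult_def
proof (rule lin_ext_mono_eval_mult)
  fix i j :: 'b
  let ?g = "gen_g :: ('a, 'b mono) alg" and ?x = "gen_x :: 'b \<Rightarrow> ('a, 'b mono) alg"
  note rel = E_relations(1,2)
  have xg: "?x i * ?g = - (?g * ?x i)" for i
    by (simp add: E_relations(3))
  show "(?g \<boxtimes> ?g) * (?g \<boxtimes> ?g) = 1"
    by (simp add: tensor_mult rel tensor_lin)
  show "(?x i \<boxtimes> 1 + ?g \<boxtimes> ?x i) * (?x i \<boxtimes> 1 + ?g \<boxtimes> ?x i) = 0"
    by (simp add: distrib_left distrib_right tensor_mult rel tensor_lin xg)
  show "(?g \<boxtimes> ?g) * (?x i \<boxtimes> 1 + ?g \<boxtimes> ?x i) = - ((?x i \<boxtimes> 1 + ?g \<boxtimes> ?x i) * (?g \<boxtimes> ?g))"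
    by (simp add: distrib_left distrib_right tensor_mult rel tensor_lin xg)
  have "?x j * ?x i = - (?x i * ?x j)" by (rule E_relations(4))
  then show "(?x i \<boxtimes> 1 + ?g \<boxtimes> ?x i) * (?x j \<boxtimes> 1 + ?g \<boxtimes> ?x j) =
      - ((?x j \<boxtimes> 1 + ?g \<boxtimes> ?x j) * (?x i \<boxtimes> 1 + ?g \<boxtimes> ?x i))"
    by (simp add: distrib_left distrib_right tensor_mult rel tensor_lin xg)
qed

lemma lin_ext_bvec: "lin_ext f (bvec b) = f b"
proof -
  have "lin_ext f (bvec b) = (\<Sum>c\<in>UNIV. if c = b then f c else 0)"
    unfolding lin_ext_def by (intro sum.cong refl) (simp add: bvec_def scl_simps)
  then show ?thesis by simp
qed

lemma comult_gen:
  "comult gen_g = gen_g \<boxtimes> gen_g" "comult (gen_x i) = gen_x i \<boxtimes> 1 + gen_g \<boxtimes> gen_x i"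
  "comult 1 = 1"
  by (simp_all add: comult_def gen_g_def gen_x_def bvec_unit[symmetric] lin_ext_bvec)
    (simp_all add: bvec_unit)?


section \<open>The quasitriangular structures \<open>R\<^sub>A\<close>\<close>

definition minor ::
  "('n::{finite, linorder} \<Rightarrow> 'n \<Rightarrow> 'k) \<Rightarrow> 'n set \<Rightarrow> 'n set \<Rightarrow> 'k::comm_ring_1" where
  "minor A P F = det (mat (card P) (card F)
     (\<lambda>(i, j). A (sorted_list_of_set P ! i) (sorted_list_of_set F ! j)))"

definition R_mat :: "('n \<Rightarrow> 'n \<Rightarrow> 'k) \<Rightarrow> ('k::field, 'n::{finite, linorder} mono \<times> 'n mono) alg" where
  "R_mat A =
     (1/2) *\<^sub>k (1 \<boxtimes> 1 + 1 \<boxtimes> gen_g + gen_g \<boxtimes> 1 - gen_g \<boxtimes> gen_g) +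
     (1/2) *\<^sub>k (\<Sum>(P, F) \<in> {(P, F). P \<noteq> {} \<and> F \<noteq> {} \<and> card F = card P}.
       ((-1) ^ (card P * (card P - 1) div 2) * minor A P F) *\<^sub>k
         (gen_g ^ card P * xprod F \<boxtimes> xprod P +
          gen_g ^ card P * xprod F \<boxtimes> gen_g * xprod P +
          gen_g ^ (card P + 1) * xprod F \<boxtimes> xprod P -
          gen_g ^ (card P + 1) * xprod F \<boxtimes> gen_g * xprod P))"

end

theory Submission
  imports Defs
begin

text \<open>Write \<open>a = R\<^sub>1\<^sub>2\<^sup>-\<^sup>1 \<chi>\<^sub>1\<^sub>3 R\<^sub>1\<^sub>2\<close> and \<open>b = \<chi>\<^sub>1\<^sub>2\<close>.  As
  \<open>Id \<otimes> \<Delta>\<close> is an algebra map, the first hexagon axiom for \<open>R exp(\<hbar>\<chi>)\<close> amounts to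
  \<open>exp(\<hbar>(a + b)) = exp(\<hbar>a) exp(\<hbar>b)\<close>, so the point is that \<open>a\<close> and \<open>b\<close> commute.  Now
  \<open>R\<^sub>A\<close> is \<open>R\<^sub>0 = 1 \<otimes> 1 + 1 \<otimes> g + g \<otimes> 1 - g \<otimes> g\<close> times a combination of elements
  \<open>g\<^bsup>|P|\<^esup>x\<^sub>F \<otimes> x\<^sub>P\<close>; these commute with \<open>\<chi>\<close>, while moving \<open>R\<^sub>0\<close> past
  \<open>gx\<^sub>p \<otimes> x\<^sub>q\<close> turns the latter into \<open>- x\<^sub>p \<otimes> gx\<^sub>q\<close>.  Hence \<open>R\<chi> = \<chi>'R\<close> with
  \<open>\<chi>' = - \<Sum>\<gamma>\<^sub>p\<^sub>q x\<^sub>p \<otimes> gx\<^sub>q\<close>, and \<open>\<chi>'\<^sub>1\<^sub>2\<close> visibly commutes with \<open>\<chi>\<^sub>1\<^sub>3\<close>.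
  The second hexagon axiom is symmetric.

  In characteristic \<open>p\<close> with \<open>n < p \<le> 2n\<close> the identity for the truncated exponentials also needs
  \<open>a\<^sup>i b\<^sup>j = 0\<close> for \<open>i + j > n\<close>.  This holds because the degree in the \<open>x\<^sub>i\<close> of the first (resp. third)
  tensor factor is a filtration in which \<open>a\<close> and \<open>b\<close> have degree 1.\<close>

section \<open>Algebra homomorphisms, linear extension and tensor products of maps\<close>

locale alg_hom =
  fixes f :: "('k::comm_ring_1, 'b::alg_basis) alg \<Rightarrow> ('k, 'c::alg_basis) alg"
  assumes hom_add: "f (u + v) = f u + f v"
    and hom_scl: "f (c *\<^sub>k u) = c *\<^sub>k f u"
    and hom_mult: "f (u * v) = f u * f v"
    and hom_one: "f 1 = 1"
begin

lemma hom_zero: "f 0 = 0"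
  using hom_add[of 0 0] by simp

lemma hom_minus: "f (- u) = - f u"
  using hom_add[of u "- u"] by (simp add: hom_zero add_eq_0_iff)

lemma hom_sum: "f (sum h S) = (\<Sum>s\<in>S. f (h s))"
  by (induction S rule: infinite_finite_induct) (simp_all add: hom_zero hom_add)

lemma hom_power: "f (u ^ m) = f u ^ m"
  by (induction m) (simp_all add: hom_one hom_mult)

lemma hom_mult_invertible: "mult_invertible u \<Longrightarrow> mult_invertible (f u)"
  unfolding mult_invertible_def by (metis hom_mult hom_one)

lemma fps_map_mult: "fps_map f (F * G) = fps_map f F * fps_map f G"
  by (rule fps_ext) (simp add: fps_map_def fps_mult_nth hom_sum hom_mult)

lemma fps_map_const: "fps_map f (fps_const u) = fps_const (f u)"
  by (rule fps_ext) (simp add: fps_map_def hom_zero)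

end

lemma fps_map_exp_hbar:
  fixes f :: "('k::field, 'b::alg_basis) alg \<Rightarrow> ('k, 'c::alg_basis) alg"
  assumes "alg_hom f"
  shows "fps_map f (exp_hbar u) = exp_hbar (f u)"
proof -
  interpret alg_hom f by fact
  show ?thesis
    by (rule fps_ext) (simp add: fps_map_def exp_hbar_def hom_scl hom_power)
qed

lemma alg_hom_comp: "alg_hom f \<Longrightarrow> alg_hom h \<Longrightarrow> alg_hom (\<lambda>u. h (f u))"
  by (simp add: alg_hom_def)

lemma scl_add_right: "c *\<^sub>k (u + v) = c *\<^sub>k u + c *\<^sub>k v"
  and scl_add_left: "(c + d) *\<^sub>k u = c *\<^sub>k u + d *\<^sub>k u"
  and scl_zero_right: "c *\<^sub>k (0 :: ('k, 'b) alg) = 0"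
  for u v :: "('k::comm_ring_1, 'b::alg_basis) alg"
  by (rule alg_eqI; simp add: coord_simps algebra_simps)+

lemma scl_sum_right: "c *\<^sub>k sum h S = (\<Sum>s\<in>S. c *\<^sub>k h s)"
  for h :: "'s \<Rightarrow> ('k::comm_ring_1, 'b::alg_basis) alg"
  by (induction S rule: infinite_finite_induct) (simp_all add: scl_zero_right scl_add_right)

lemma coord_add: "coord (u + v) b = coord u b + coord v b"
  and coord_scl: "coord (c *\<^sub>k u) b = c * coord u b"
  and coord_zero: "coord (0 :: ('k, 'b) alg) b = 0"
  for u v :: "('k::comm_ring_1, 'b::alg_basis) alg"
  by (simp_all add: coord_simps)

lemma lin_ext_add: "lin_ext f (u + v) = lin_ext f u + lin_ext f v"
  and lin_ext_scl: "lin_ext f (c *\<^sub>k u) = c *\<^sub>k lin_ext f u"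
  for u v :: "('k::comm_ring_1, 'b::alg_basis) alg"
  by (simp_all add: lin_ext_def coord_add coord_scl scl_add_left sum.distrib scl_sum_right scl_scl)

lemma lin_ext_hom: "alg_hom f \<Longrightarrow> lin_ext (\<lambda>b. f (bvec b)) u = f u"
  by (subst (3) bvec_expand) (simp add: lin_ext_def alg_hom.hom_sum alg_hom.hom_scl)

text \<open>Multiplicativity is a bilinear condition, so it can be tested on pairs of basis vectors.
  Their product need not be a basis vector, hence the \<open>lin_ext\<close> on the left of
  \<open>mult\<close>.\<close>

lemma alg_hom_lin_extI:
  fixes f :: "'b::alg_basis \<Rightarrow> ('k::comm_ring_1, 'c::alg_basis) alg"
  assumes mult: "\<And>a b. lin_ext f (bvec a * bvec b) = f a * f b" and one: "lin_ext f 1 = 1"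
  shows "alg_hom (lin_ext f)"
proof
  fix u v :: "('k, 'b) alg"
  have sum: "lin_ext f (sum h S) = (\<Sum>s\<in>S. lin_ext f (h s))" for h and S :: "'s set"
  proof (induction S rule: infinite_finite_induct)
    case (insert s S)
    then show ?case by (simp add: lin_ext_add)
  qed (simp_all add: lin_ext_def coord_zero scl_simps)
  have "lin_ext f (u * v) = lin_ext f (\<Sum>a\<in>UNIV. \<Sum>b\<in>UNIV.
      (coord u a * coord v b) *\<^sub>k (bvec a * bvec b))"
    by (subst bvec_expand[of u], subst bvec_expand[of v])
      (simp add: sum_product scl_mult_left scl_mult_right scl_scl mult_ac)
  also have "\<dots> = (\<Sum>a\<in>UNIV. \<Sum>b\<in>UNIV. (coord u a * coord v b) *\<^sub>k (f a * f b))"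
    by (simp add: sum lin_ext_scl mult)
  also have "\<dots> = lin_ext f u * lin_ext f v"
    by (simp add: lin_ext_def sum_product scl_mult_left scl_mult_right scl_scl mult_ac)
  finally show "lin_ext f (u * v) = lin_ext f u * lin_ext f v" .
qed (simp_all add: lin_ext_add lin_ext_scl one)

lemma tensor_scl: "(c *\<^sub>k u) \<boxtimes> v = c *\<^sub>k (u \<boxtimes> v)" "u \<boxtimes> (c *\<^sub>k v) = c *\<^sub>k (u \<boxtimes> v)"
  for u :: "('k::comm_ring_1, 'b::alg_basis) alg" and v :: "('k, 'c::alg_basis) alg"
  by (rule alg_eqI; auto simp: coord_simps mult_ac split: prod.splits)+

lemma tensor_sum: "sum h S \<boxtimes> v = (\<Sum>s\<in>S. h s \<boxtimes> v)" "u \<boxtimes> sum h' S = (\<Sum>s\<in>S. u \<boxtimes> h' s)"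
  for u :: "('k::comm_ring_1, 'b::alg_basis) alg" and v :: "('k, 'c::alg_basis) alg"
  by (induction S rule: infinite_finite_induct; simp add: tensor_lin)+

lemma bvec_Pair: "bvec (a, b) = bvec a \<boxtimes> bvec b"
  by (rule alg_eqI) (auto simp: coord_simps split: prod.splits)

lemma tensor_map_tensor:
  assumes "alg_hom f" "alg_hom g"
  shows "tensor_map f g (u \<boxtimes> v) = f u \<boxtimes> g v"
proof -
  have "tensor_map f g (u \<boxtimes> v) =
      (\<Sum>(a, b)\<in>UNIV \<times> UNIV. (coord u a * coord v b) *\<^sub>k (f (bvec a) \<boxtimes> g (bvec b)))"
    by (simp add: tensor_map_def lin_ext_def tensor_def case_prod_unfold)
  also have "\<dots> = lin_ext (\<lambda>a. f (bvec a)) u \<boxtimes> lin_ext (\<lambda>b. g (bvec b)) v"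
    unfolding sum.cartesian_product[symmetric] lin_ext_def tensor_sum(1)
    by (simp add: tensor_sum(2) tensor_scl scl_scl scl_sum_right mult.commute)
  finally show ?thesis by (simp add: lin_ext_hom assms)
qed

lemma alg_hom_tensor_map:
  assumes "alg_hom f" "alg_hom g"
  shows "alg_hom (tensor_map f g)"
  unfolding tensor_map_def
proof (rule alg_hom_lin_extI, unfold tensor_map_def[symmetric])
  note simps = tensor_map_tensor[OF assms] alg_hom.hom_mult[OF assms(1)]
    alg_hom.hom_mult[OF assms(2)] alg_hom.hom_one[OF assms(1)] alg_hom.hom_one[OF assms(2)]
  show "tensor_map f g 1 = 1"
    unfolding tensor_lin(7)[symmetric] by (simp add: simps)
  show "tensor_map f g (bvec x * bvec y) =
      (case x of (a, b) \<Rightarrow> f (bvec a) \<boxtimes> g (bvec b)) * (case y of (a, b) \<Rightarrow> f (bvec a) \<boxtimes> g (bvec b))"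
    for x y
    by (cases x; cases y) (simp add: bvec_Pair tensor_mult simps)
qed

section \<open>Rebracketing and the leg embeddings as algebra maps\<close>

lemma assoc_tensor_tensor: "assoc_tensor ((u \<boxtimes> v) \<boxtimes> w) = u \<boxtimes> v \<boxtimes> w"
  by (rule alg_eqI) (auto simp: assoc_tensor_def tensor_def mult_ac split: prod.splits)

text \<open>\<open>assoc_tensor\<close> is defined by coordinates; this form makes
  \<open>alg_hom_lin_extI\<close> applicable.\<close>

lemma assoc_tensor_eq_lin_ext:
  "(assoc_tensor :: ('k::comm_ring_1, ('a::alg_basis \<times> 'b::alg_basis) \<times> 'c::alg_basis) alg \<Rightarrow> _) =
    lin_ext (\<lambda>((a, b), c). bvec a \<boxtimes> bvec b \<boxtimes> bvec c)"
proof
  fix T :: "('k, ('a \<times> 'b) \<times> 'c) alg"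
  have "coord (assoc_tensor T) (a, b, c) =
      coord (lin_ext (\<lambda>((a, b), c). bvec a \<boxtimes> bvec b \<boxtimes> bvec c) T) (a, b, c)" for a b c
  proof -
    have "coord (lin_ext (\<lambda>((a, b), c). bvec a \<boxtimes> bvec b \<boxtimes> bvec c) T) (a, b, c) =
        (\<Sum>z\<in>UNIV. if z = ((a, b), c) then coord T z else 0)"
      unfolding lin_ext_def coord_sum
      by (intro sum.cong refl) (auto simp: coord_simps split: prod.splits)
    then show ?thesis by (simp add: assoc_tensor_def)
  qed
  then show "assoc_tensor T = lin_ext (\<lambda>((a, b), c). bvec a \<boxtimes> bvec b \<boxtimes> bvec c) T"
    by (intro alg_eqI) auto
qed

lemma alg_hom_assoc_tensor:
  "alg_hom (assoc_tensor :: ('k::comm_ring_1, ('a::alg_basis \<times> 'b::alg_basis) \<times> 'c::alg_basis) alg \<Rightarrow> _)"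
  (is "alg_hom ?f")
proof -
  let ?h = "\<lambda>((a, b), c). bvec a \<boxtimes> bvec b \<boxtimes> bvec c"
  have "?f (bvec x * bvec y) = ?h x * ?h y" for x y
    by (cases x; cases y) (auto simp: bvec_Pair tensor_mult assoc_tensor_tensor)
  moreover have "?f 1 = 1"
    unfolding tensor_lin(7)[symmetric] by (simp add: assoc_tensor_tensor)
  ultimately show ?thesis
    unfolding assoc_tensor_eq_lin_ext by (rule alg_hom_lin_extI)
qed

lemma alg_hom_tensor_one: "alg_hom (\<lambda>u. u \<boxtimes> 1)"
  and alg_hom_one_tensor: "alg_hom (\<lambda>v. 1 \<boxtimes> v)"
  by unfold_locales (simp_all add: tensor_lin tensor_scl tensor_mult)

lemma alg_hom_id: "alg_hom id"
  by unfold_locales simp_all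

lemma alg_hom_comult: "alg_hom comult"
  by unfold_locales (simp_all add: comult_mult comult_gen, simp_all add: comult_def lin_ext_add lin_ext_scl)

lemma alg_hom_leg12: "alg_hom leg12"
  unfolding leg12_def[abs_def] using alg_hom_comp[OF alg_hom_tensor_one alg_hom_assoc_tensor] .

lemma alg_hom_leg23: "alg_hom leg23"
  unfolding leg23_def[abs_def] by (rule alg_hom_one_tensor)

text \<open>Inserting 1 in the middle acts on the second factor alone, so
  \<open>alg_hom_tensor_map\<close> covers this leg as well.\<close>

lemma leg13_eq_tensor_map: "leg13 = tensor_map id (\<lambda>v. 1 \<boxtimes> v)"
  by (simp add: leg13_def tensor_map_def)

lemma alg_hom_leg13: "alg_hom leg13"
  unfolding leg13_eq_tensor_map by (intro alg_hom_tensor_map alg_hom_id alg_hom_one_tensor)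

lemma alg_hom_id_tensor: "alg_hom \<Delta> \<Longrightarrow> alg_hom (id_tensor \<Delta>)"
  unfolding id_tensor_def by (intro alg_hom_tensor_map alg_hom_id)

lemma alg_hom_tensor_id: "alg_hom \<Delta> \<Longrightarrow> alg_hom (tensor_id \<Delta>)"
  unfolding tensor_id_def[abs_def]
  by (intro alg_hom_comp[OF _ alg_hom_assoc_tensor] alg_hom_tensor_map alg_hom_id)

lemma leg_tensor:
  "leg12 (u \<boxtimes> v) = u \<boxtimes> v \<boxtimes> 1" "leg13 (u \<boxtimes> v) = u \<boxtimes> 1 \<boxtimes> v" "leg23 (u \<boxtimes> v) = 1 \<boxtimes> u \<boxtimes> v"
  by (simp_all add: leg12_def leg23_def leg13_eq_tensor_map assoc_tensor_tensor
      tensor_map_tensor alg_hom_id alg_hom_one_tensor)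


section \<open>Filtrations by a weight of basis vectors\<close>

text \<open>The span of the basis vectors of weight at least \<open>m\<close>. It is a filtration
  rather than a grading because the R-matrix is in general not homogeneous, while conjugation still
  preserves the filtration.\<close>

definition weight_filt :: "('b \<Rightarrow> nat) \<Rightarrow> nat \<Rightarrow> ('k::comm_ring_1, 'b) alg set" where
  "weight_filt w m = {u. \<forall>b. coord u b \<noteq> 0 \<longrightarrow> m \<le> w b}"

definition superadditive :: "('b::alg_basis \<Rightarrow> nat) \<Rightarrow> bool" where
  "superadditive w \<longleftrightarrow> (\<forall>a b c. sc a b c \<noteq> 0 \<longrightarrow> w a + w b \<le> w c)"

lemma superadditive_fst: "superadditive w \<Longrightarrow> superadditive (\<lambda>b. w (fst b))"
  and superadditive_snd: "superadditive w \<Longrightarrow> superadditive (\<lambda>b. w (snd b))"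
  by (auto simp: superadditive_def sc_prod_def)

lemma weight_filt_zero: "0 \<in> weight_filt w m"
  by (simp add: weight_filt_def coord_simps)

lemma weight_filt_0: "u \<in> weight_filt w 0"
  by (simp add: weight_filt_def)

lemma weight_filt_add: "u \<in> weight_filt w m \<Longrightarrow> v \<in> weight_filt w m \<Longrightarrow> u + v \<in> weight_filt w m"
  by (force simp: weight_filt_def coord_simps)

lemma weight_filt_scl: "u \<in> weight_filt w m \<Longrightarrow> c *\<^sub>k u \<in> weight_filt w m"
  by (force simp: weight_filt_def coord_simps)

lemma weight_filt_sum:
  fixes h :: "'s \<Rightarrow> ('k::comm_ring_1, 'b::alg_basis) alg"
  shows "(\<And>s. s \<in> S \<Longrightarrow> h s \<in> weight_filt w m) \<Longrightarrow> sum h S \<in> weight_filt w m"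
  by (induction S rule: infinite_finite_induct) (simp_all add: weight_filt_zero weight_filt_add)

lemma weight_filt_mult:
  assumes w: "superadditive w" and u: "u \<in> weight_filt w m" and v: "v \<in> weight_filt w m'"
  shows "u * v \<in> weight_filt w (m + m')"
proof -
  have "m + m' \<le> w c" if nz: "coord (u * v) c \<noteq> 0" for c
  proof -
    from nz have "(\<Sum>a\<in>UNIV. \<Sum>b\<in>UNIV. coord u a * coord v b * of_int (sc a b c)) \<noteq> 0"
      by (simp add: times_alg_def)
    then obtain a b where "coord u a * coord v b * of_int (sc a b c) \<noteq> 0"
      by (meson sum.not_neutral_contains_not_neutral)
    then have "coord u a \<noteq> 0" "coord v b \<noteq> 0" "sc a b c \<noteq> 0" by auto
    with assms show ?thesis
      by (fastforce simp: weight_filt_def superadditive_def)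
  qed
  then show ?thesis by (simp add: weight_filt_def)
qed

lemma weight_filt_power:
  "superadditive w \<Longrightarrow> u \<in> weight_filt w 1 \<Longrightarrow> u ^ m \<in> weight_filt w m"
proof (induction m)
  case (Suc m)
  then show ?case using weight_filt_mult[of w u 1 "u ^ m" m] by simp
qed (simp add: weight_filt_0)

text \<open>For a bounded weight the filtration reaches 0, which is the source of all nilpotency
  below.\<close>

lemma weight_filt_eq_0: "u \<in> weight_filt w m \<Longrightarrow> (\<And>b. w b < m) \<Longrightarrow> u = 0"
  by (intro alg_eqI) (auto simp: weight_filt_def coord_zero simp flip: not_le)

lemma weight_filt_tensor:
  "u \<in> weight_filt w m \<Longrightarrow> u \<boxtimes> v \<in> weight_filt (\<lambda>b. w (fst b)) m"
  "v \<in> weight_filt w' m \<Longrightarrow> u \<boxtimes> v \<in> weight_filt (\<lambda>b. w' (snd b)) m"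
  unfolding weight_filt_def tensor_def by (auto, (fastforce dest: mult_not_zero)+)


section \<open>Truncated exponentials\<close>

text \<open>The divided power u^m / m!, which is the junk value 0 when m! = 0 in the field.\<close>

definition div_pow :: "nat \<Rightarrow> ('k::field, 'b::alg_basis) alg \<Rightarrow> ('k, 'b) alg" where
  "div_pow m u = (1 / of_nat (fact m)) *\<^sub>k u ^ m"

lemma div_pow_Suc:
  assumes "of_nat (fact (Suc m)) \<noteq> (0 :: 'k::field)"
  shows "of_nat (Suc m) *\<^sub>k div_pow (Suc m) u = u * div_pow m (u :: ('k, 'b::alg_basis) alg)"
proof -
  have "of_nat (Suc m) * (1 / of_nat (fact (Suc m))) = (1 / of_nat (fact m) :: 'k)"
    using assms unfolding fact_Suc of_nat_mult by (simp add: divide_simps del: of_nat_Suc)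
  then show ?thesis
    by (simp add: div_pow_def scl_mult_right scl_scl del: fact_Suc of_nat_Suc)
qed

text \<open>The binomial theorem for divided powers. Multiplying by m + 1 and using the recursion
  \<open>div_pow_Suc\<close> avoids binomial coefficients.\<close>

lemma div_pow_add:
  fixes a b :: "('k::field, 'b::alg_basis) alg"
  assumes ab: "a * b = b * a" and "of_nat (fact m) \<noteq> (0 :: 'k)"
  shows "div_pow m (a + b) = (\<Sum>i\<le>m. div_pow i a * div_pow (m - i) b)"
  using assms(2)
proof (induction m)
  case 0
  then show ?case by (simp add: div_pow_def scl_simps)
next
  case (Suc m)
  let ?s = "\<lambda>i. div_pow i a * div_pow (Suc m - i) b"
  have nz: "of_nat (Suc m) \<noteq> (0 :: 'k)" "of_nat (fact m) \<noteq> (0 :: 'k)"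
    using Suc.prems unfolding fact_Suc of_nat_mult by simp_all
  \<comment> \<open>i! divides (m + 1)!, so the smaller factorials cannot vanish either.\<close>
  have fact_nz: "of_nat (fact i) \<noteq> (0 :: 'k)" if "i \<le> Suc m" for i
    using Suc.prems fact_dvd[OF that, where 'a = nat]
    by (metis dvd_def mult_zero_left of_nat_mult)
  have bi: "b * div_pow i a = div_pow i a * b" for i
    using power_commuting_commutes[OF ab] by (simp add: div_pow_def scl_mult_left scl_mult_right)
  have "of_nat (Suc m) *\<^sub>k div_pow (Suc m) (a + b) = (a + b) * div_pow m (a + b)"
    using Suc.prems by (rule div_pow_Suc)
  also have "\<dots> = (\<Sum>i\<le>m. (a * div_pow i a) * div_pow (m - i) b) +
      (\<Sum>i\<le>m. div_pow i a * (b * div_pow (m - i) b))"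
    using Suc.IH[OF nz(2)]
    by (simp add: distrib_right sum_distrib_left sum.distrib mult.assoc[symmetric] bi)
  also have "(\<Sum>i\<le>m. (a * div_pow i a) * div_pow (m - i) b) =
      (\<Sum>i\<le>m. of_nat (Suc i) *\<^sub>k ?s (Suc i))"
    by (intro sum.cong refl) (simp del: of_nat_Suc add: div_pow_Suc[OF fact_nz, symmetric] scl_mult_left)
  \<comment> \<open>The added term i = 0 has coefficient 0; likewise i = m + 1 in the second sum
    below. Both sums then have the same range, and their coefficients add up to m + 1.\<close>
  also have "\<dots> = (\<Sum>i\<le>Suc m. of_nat i *\<^sub>k ?s i)"
    by (subst (1) sum.atMost_Suc_shift) (simp add: scl_simps)
  also have "(\<Sum>i\<le>m. div_pow i a * (b * div_pow (m - i) b)) = (\<Sum>i\<le>m. of_nat (Suc m - i) *\<^sub>k ?s i)"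
    by (intro sum.cong refl)
      (simp del: of_nat_Suc add: div_pow_Suc[OF fact_nz, symmetric] scl_mult_right Suc_diff_le)
  also have "\<dots> = (\<Sum>i\<le>Suc m. of_nat (Suc m - i) *\<^sub>k ?s i)"
    by (simp add: scl_simps)
  also have "(\<Sum>i\<le>Suc m. of_nat i *\<^sub>k ?s i) + (\<Sum>i\<le>Suc m. of_nat (Suc m - i) *\<^sub>k ?s i) =
      of_nat (Suc m) *\<^sub>k (\<Sum>i\<le>Suc m. ?s i)"
    unfolding scl_sum_right sum.distrib[symmetric] scl_add_left[symmetric] of_nat_add[symmetric]
    by (intro sum.cong refl) simp
  finally have "(1 / of_nat (Suc m)) *\<^sub>k of_nat (Suc m) *\<^sub>k div_pow (Suc m) (a + b) =
      (1 / of_nat (Suc m)) *\<^sub>k of_nat (Suc m) *\<^sub>k (\<Sum>i\<le>Suc m. ?s i)"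
    by simp
  then show ?case
    using nz(1) by (simp del: of_nat_Suc sum.atMost_Suc add: scl_scl scl_simps)
qed

text \<open>Up to degree \<open>N\<close> this is \<open>div_pow_add\<close>. For m >
  \<open>N\<close>, products of m factors of weight 1 lie in \<open>weight_filt w m\<close>, which
  is 0, so both sides vanish whatever the value of 1/m!.\<close>

lemma exp_hbar_add:
  fixes a b :: "('k::field, 'b::alg_basis) alg"
  assumes ab: "a * b = b * a" and N: "of_nat (fact N) \<noteq> (0 :: 'k)"
    and w: "superadditive w" "\<And>b. w b \<le> N" and filt: "a \<in> weight_filt w 1" "b \<in> weight_filt w 1"
  shows "exp_hbar (a + b) = exp_hbar a * exp_hbar b"
proof (rule fps_ext)
  fix m
  have "div_pow m (a + b) = (\<Sum>i\<le>m. div_pow i a * div_pow (m - i) b)"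
  proof (cases "m \<le> N")
    case True
    then have "of_nat (fact m) \<noteq> (0 :: 'k)"
      using N fact_dvd[OF True, where 'a = nat] by (metis dvd_def mult_zero_left of_nat_mult)
    then show ?thesis by (rule div_pow_add[OF ab])
  next
    case False
    then have null: "u \<in> weight_filt w m \<Longrightarrow> u = 0" for u :: "('k, 'b) alg"
      using w(2) by (metis weight_filt_eq_0 not_le le_less_trans)
    have "a ^ i * b ^ (m - i) = 0" if "i \<le> m" for i
      using null weight_filt_mult[OF w(1) weight_filt_power[OF w(1) filt(1), of i]
          weight_filt_power[OF w(1) filt(2), of "m - i"]] that by simp
    moreover have "(a + b) ^ m = 0"
      by (intro null weight_filt_power w(1) weight_filt_add filt)
    ultimately show ?thesis
      by (simp add: div_pow_def scl_mult_left scl_mult_right scl_zero_right)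
  qed
  then show "fps_nth (exp_hbar (a + b)) m = fps_nth (exp_hbar a * exp_hbar b) m"
    by (simp add: exp_hbar_def fps_mult_nth div_pow_def atMost_atLeast0)
qed

lemma exp_hbar_zero: "exp_hbar 0 = 1"
  by (rule fps_ext) (simp add: exp_hbar_def power_0_left scl_simps scl_zero_right)

lemma exp_hbar_inverse:
  fixes u :: "('k::field, 'b::alg_basis) alg"
  assumes "of_nat (fact N) \<noteq> (0 :: 'k)" "superadditive w" "\<And>b. w b \<le> N" "u \<in> weight_filt w 1"
  shows "exp_hbar u * exp_hbar (- u) = 1" "exp_hbar (- u) * exp_hbar u = 1"
proof -
  have m: "- u \<in> weight_filt w 1"
    using weight_filt_scl[OF assms(4), of "- 1"] by (simp add: scl_simps)
  show "exp_hbar u * exp_hbar (- u) = 1" "exp_hbar (- u) * exp_hbar u = 1"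
    using exp_hbar_add[OF _ assms(1-4) m] exp_hbar_add[OF _ assms(1-3) m assms(4)]
    by (simp_all add: exp_hbar_zero)
qed

text \<open>An intertwining relation passes to all powers, and thus to each coefficient of the
  series.\<close>

lemma exp_hbar_conj:
  assumes "r * v = u * r"
  shows "fps_const r * exp_hbar v = exp_hbar u * fps_const r"
proof (rule fps_ext)
  fix m
  have "r * v ^ m = u ^ m * r"
  proof (induction m)
    case (Suc m)
    have "r * v ^ Suc m = (r * v) * v ^ m" by (simp add: mult.assoc)
    also have "\<dots> = u * (r * v ^ m)" by (simp add: assms mult.assoc)
    finally show ?case by (simp add: Suc.IH mult.assoc)
  qed simp
  then show "fps_nth (fps_const r * exp_hbar v) m = fps_nth (exp_hbar u * fps_const r) m"
    by (simp add: exp_hbar_def scl_mult_left scl_mult_right)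
qed

lemma exp_hbar_commute:
  assumes "\<And>m. u * fps_nth F m = fps_nth F m * u"
  shows "exp_hbar u * F = F * exp_hbar u"
proof (rule fps_ext)
  fix m
  have "fps_nth (exp_hbar u * F) m = (\<Sum>i=0..m. fps_nth F (m - i) * fps_nth (exp_hbar u) i)"
    unfolding fps_mult_nth
    by (intro sum.cong refl) (simp add: exp_hbar_def scl_mult_left scl_mult_right power_commuting_commutes assms)
  also have "\<dots> = fps_nth (F * exp_hbar u) m"
    \<comment> \<open>Reversing the summation index exchanges the two factors of the Cauchy
      product.\<close>
    unfolding fps_mult_nth by (subst sum.atLeastAtMost_rev) (intro sum.cong refl, simp)
  finally show "fps_nth (exp_hbar u * F) m = fps_nth (F * exp_hbar u) m" .
qed

lemma mult_inv_eqI: "a * b = 1 \<Longrightarrow> b * a = 1 \<Longrightarrow> mult_inv a = b"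
  unfolding mult_inv_def by (rule the_equality) (auto, metis mult.assoc mult_1_left mult_1_right)

text \<open>Both hexagon axioms are instances: \<open>f\<close> is \<open>Id \<otimes> \<Delta>\<close> or \<open>\<Delta> \<otimes> Id\<close>, \<open>i\<close> is the
  embedding into the legs 1 and 3 and \<open>j\<close> the one into the legs 1, 2 or 2, 3.\<close>

lemma exp_hbar_hexagon:
  fixes R \<chi> :: "('k::field, 'b::alg_basis) alg"
    and f i j :: "('k, 'b) alg \<Rightarrow> ('k, 'c::alg_basis) alg"
  assumes hom: "alg_hom f" "alg_hom i" "alg_hom j"
    and inv: "mult_invertible R"
    and f_R: "f R = i R * j R"
    and f_\<chi>: "f \<chi> = j \<chi> + mult_inv (j R) * i \<chi> * j R"
    and twist: "R * \<chi> = \<chi>' * R" and comm: "j \<chi>' * i \<chi> = i \<chi> * j \<chi>'"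
    and N: "of_nat (fact N) \<noteq> (0 :: 'k)"
    and w: "superadditive w" "\<And>b. w b \<le> N"
    and filt: "i \<chi> \<in> weight_filt w 1" "j \<chi> \<in> weight_filt w 1"
  shows "fps_map f (fps_const R * exp_hbar \<chi>) =
    fps_map i (fps_const R * exp_hbar \<chi>) * fps_map j (fps_const R * exp_hbar \<chi>)"
proof -
  define r where "r = j R"
  define s where "s = mult_inv r"
  define c where "c = s * i \<chi> * r"
  have "mult_invertible r"
    unfolding r_def using hom(3) inv by (rule alg_hom.hom_mult_invertible)
  then have rs: "r * s = 1" and sr: "s * r = 1"
    by (simp_all add: s_def mult_inv)
  have rc: "r * c = i \<chi> * r"
    unfolding c_def by (simp add: mult.assoc[symmetric] rs)
  have r\<chi>: "r * j \<chi> = j \<chi>' * r"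
    unfolding r_def by (simp add: alg_hom.hom_mult[OF hom(3), symmetric] twist)
  \<comment> \<open>Conjugation by \<open>r\<close> carries \<open>j \<chi>\<close> to
    \<open>j \<chi>'\<close> and \<open>c\<close> to \<open>i \<chi>\<close>; these two commute by
    \<open>comm\<close>.\<close>
  have "r * (j \<chi> * c) = j \<chi>' * i \<chi> * r"
    by (metis mult.assoc r\<chi> rc)
  also have "\<dots> = r * (c * j \<chi>)"
    by (metis mult.assoc r\<chi> rc comm)
  finally have "s * r * (j \<chi> * c) = s * r * (c * j \<chi>)"
    by (simp only: mult.assoc)
  then have cj: "c * j \<chi> = j \<chi> * c"
    by (simp add: sr)
  \<comment> \<open>The conjugating factors \<open>s\<close> and \<open>r\<close> count with weight
    0.\<close>
  have "c \<in> weight_filt w (0 + 1 + 0)"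
    unfolding c_def by (intro weight_filt_mult w weight_filt_0 filt)
  then have "exp_hbar (c + j \<chi>) = exp_hbar c * exp_hbar (j \<chi>)"
    using filt by (intro exp_hbar_add[OF cj N w]) simp_all
  moreover have "f \<chi> = c + j \<chi>"
    by (simp add: f_\<chi> c_def s_def r_def add.commute)
  ultimately have "fps_map f (fps_const R * exp_hbar \<chi>) =
      fps_const (i R) * (fps_const r * exp_hbar c) * exp_hbar (j \<chi>)"
    by (simp add: alg_hom.fps_map_mult alg_hom.fps_map_const fps_map_exp_hbar hom f_R r_def
        mult.assoc fps_const_mult[symmetric] del: fps_const_mult)
  \<comment> \<open>Moving \<open>r\<close> to the right undoes the conjugation, which leaves
    \<open>i R\<close> next to exp of \<open>i \<chi>\<close> and \<open>r = j R\<close> next to exp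
    of \<open>j \<chi>\<close>.\<close>
  also have "fps_const r * exp_hbar c = exp_hbar (i \<chi>) * fps_const r"
    by (rule exp_hbar_conj[OF rc])
  also have "fps_const (i R) * (exp_hbar (i \<chi>) * fps_const r) * exp_hbar (j \<chi>) =
      fps_map i (fps_const R * exp_hbar \<chi>) * fps_map j (fps_const R * exp_hbar \<chi>)"
    by (simp add: alg_hom.fps_map_mult alg_hom.fps_map_const fps_map_exp_hbar hom r_def mult.assoc)
  finally show ?thesis .
qed


section \<open>The algebra \<open>E(n)\<close>\<close>

fun mono_deg :: "'n mono \<Rightarrow> nat" where
  "mono_deg (Gx a P) = card P"

text \<open>A nonzero sign forces the two index sets to be disjoint, so that degrees add.\<close>

lemma superadditive_mono_deg: "superadditive (mono_deg :: 'n::{finite, linorder} mono \<Rightarrow> nat)"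
proof -
  have "mono_deg a + mono_deg b \<le> mono_deg c" if "sc a b c \<noteq> 0" for a b c :: "'n mono"
    using that by (cases a; cases b) (auto simp: sc_mono_def card_Un_disjoint split: if_splits)
  then show ?thesis by (simp add: superadditive_def)
qed

lemma mono_deg_le: "mono_deg (b :: 'n::finite mono) \<le> CARD('n)"
  by (cases b) (simp add: card_mono)

lemma gen_x_filt: "gen_x i \<in> weight_filt mono_deg 1"
  by (auto simp: weight_filt_def gen_x_def bvec_def)

lemma g_x_filt: "gen_g * gen_x i \<in> weight_filt mono_deg 1"
  using weight_filt_mult[OF superadditive_mono_deg weight_filt_0 gen_x_filt] by simp

lemma g_pow: "(gen_g :: ('k::comm_ring_1, 'n::{finite, linorder} mono) alg) ^ m = (if even m then 1 else gen_g)"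
  by (induction m) (auto simp: E_relations)

text \<open>Each of the \<open>card P\<close> factors contributes one sign. The cases of interest
  are y = \<open>gen_g\<close> and y = \<open>gen_x j\<close>.\<close>

lemma xprod_anticommute:
  fixes y :: "('k::comm_ring_1, 'n::{finite, linorder} mono) alg"
  assumes "\<And>i. gen_x i * y = - (y * gen_x i)"
  shows "xprod P * y = (if even (card P) then y * xprod P else - (y * xprod P))"
proof -
  have "prod_list (map gen_x xs) * y = (- 1) ^ length xs * (y * prod_list (map gen_x xs))" for xs
  proof (induction xs)
    case (Cons i xs)
    then show ?case
      by (cases "even (length xs)") (simp_all add: mult.assoc, simp_all add: mult.assoc[symmetric] assms)
  qed simp
  from this[of "sorted_list_of_set P"] show ?thesis
    by (simp add: xprod_def minus_one_power_iff)
qed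

text \<open>Twice the structure \<open>R\<^sub>A\<close> for \<open>A = 0\<close>.\<close>

definition R0 :: "('k::comm_ring_1, 'n::{finite, linorder} mono \<times> 'n mono) alg" where
  "R0 = 1 \<boxtimes> 1 + 1 \<boxtimes> gen_g + gen_g \<boxtimes> 1 - gen_g \<boxtimes> gen_g"

text \<open>Writing x, x' for \<open>gen_x p\<close>, \<open>gen_x q\<close> and g for
  \<open>gen_g\<close>, both sides expand to gx \<otimes> x' + gx \<otimes> gx' + x \<otimes> x' - x
  \<otimes> gx'.\<close>

lemma R0_twist:
  "(R0 :: ('k::comm_ring_1, _) alg) * (gen_g * gen_x p \<boxtimes> gen_x q) = - (gen_x p \<boxtimes> gen_g * gen_x q) * R0"
proof -
  have rel: "gen_x i * gen_g = - (gen_g * gen_x i :: ('k, 'n::{finite, linorder} mono) alg)"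
    "gen_x i * (gen_g * y) = - (gen_g * (gen_x i * y) :: ('k, 'n mono) alg)" 
    "gen_g * (gen_g * y) = (y :: ('k, 'n mono) alg)" for i y
    by (simp_all add: E_relations(1,3) mult.assoc[symmetric])
  show ?thesis
    by (simp add: R0_def algebra_simps tensor_mult tensor_lin rel E_relations(1))
qed

text \<open>In the first factor, \<open>xprod F\<close> passes g and \<open>gen_x p\<close> with
  equal signs, which cancel, and the power of g passes with (-1)^|P|. In the second,
  \<open>xprod P\<close> passes \<open>gen_x q\<close> with the same sign (-1)^|P|.\<close>

lemma pair_commute:
  fixes p q :: "'n::{finite, linorder}"
  assumes "card F = card P"
  shows "(gen_g ^ card P * xprod F \<boxtimes> xprod P) * (gen_g * gen_x p \<boxtimes> gen_x q) =
    (gen_g * gen_x p \<boxtimes> gen_x q) * (gen_g ^ card P * xprod F \<boxtimes> xprod P :: ('k::comm_ring_1, _) alg)"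
proof -
  let ?g = "gen_g :: ('k, 'n mono) alg" and ?x = "gen_x :: 'n \<Rightarrow> ('k, 'n mono) alg"
  have xg: "?x i * ?g = - (?g * ?x i)" for i by (simp add: E_relations(3))
  have xx: "?x i * ?x j = - (?x j * ?x i)" for i j by (rule E_relations(4))
  have Fg: "xprod F * ?g = (if even (card P) then ?g * xprod F else - (?g * xprod F))"
    using xprod_anticommute[OF xg, of F] assms by simp
  have Fx: "xprod F * ?x p = (if even (card P) then ?x p * xprod F else - (?x p * xprod F))"
    using xprod_anticommute[OF xx, of F] assms by simp
  have Px: "xprod P * ?x q = (if even (card P) then ?x q * xprod P else - (?x q * xprod P))"
    using xprod_anticommute[OF xx, of P] by simp
  have "xprod F * (?g * ?x p) = (?g * ?x p) * xprod F"
  proof -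
    have "xprod F * (?g * ?x p) = (xprod F * ?g) * ?x p" by (simp add: mult.assoc)
    also have "\<dots> = (?g * ?x p) * xprod F" by (simp add: Fg Fx mult.assoc)
    finally show ?thesis .
  qed
  moreover have "?g * (?g * ?x p) = - ((?g * ?x p) * ?g)"
    by (simp add: xg mult.assoc)
  ultimately have "(?g ^ card P * xprod F) * (?g * ?x p) =
      (if even (card P) then 1 else - 1) * ((?g * ?x p) * (?g ^ card P * xprod F))"
    by (simp add: g_pow mult.assoc) (simp add: mult.assoc[symmetric] E_relations(1) xg)
  then show ?thesis
    by (simp add: tensor_mult Px tensor_lin)
qed

text \<open>The four terms belonging to a pair (P, F) are the product of \<open>R0\<close> with a
  single tensor; the leading 1 is the contribution of P = F = {}.\<close>

lemma R_mat_factor: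
  fixes A :: "'n::{finite, linorder} \<Rightarrow> 'n \<Rightarrow> 'k::field"
  shows "R_mat A = (1/2) *\<^sub>k R0 * (1 + (\<Sum>(P, F) \<in> {(P, F). P \<noteq> {} \<and> F \<noteq> {} \<and> card F = card P}.
    ((-1) ^ (card P * (card P - 1) div 2) * minor A P F) *\<^sub>k (gen_g ^ card P * xprod F \<boxtimes> xprod P)))"
proof -
  have "gen_g ^ m * u \<boxtimes> v + gen_g ^ m * u \<boxtimes> gen_g * v + gen_g ^ (m + 1) * u \<boxtimes> v -
      gen_g ^ (m + 1) * u \<boxtimes> gen_g * v = R0 * (gen_g ^ m * u \<boxtimes> v)"
    for m and u v :: "('k, 'n mono) alg"
    by (simp add: R0_def distrib_right left_diff_distrib tensor_mult mult.assoc tensor_lin)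
  then show ?thesis
    unfolding R_mat_def R0_def[symmetric]
    by (simp del: power_Suc add: distrib_left scl_mult_left scl_mult_right sum_distrib_left
        case_prod_unfold scl_sum_right scl_scl mult.commute)
qed

lemma R_mat_twist:
  assumes "\<chi> = (\<Sum>p\<in>UNIV. \<Sum>q\<in>UNIV. \<gamma> p q *\<^sub>k (gen_g * gen_x p \<boxtimes> gen_x q))"
  shows "R_mat A * \<chi> =
    (\<Sum>p\<in>UNIV. \<Sum>q\<in>UNIV. \<gamma> p q *\<^sub>k - (gen_x p \<boxtimes> gen_g * gen_x q)) * R_mat A"
proof -
  have "(gen_g ^ card P * xprod F \<boxtimes> xprod P) * \<chi> = \<chi> * (gen_g ^ card P * xprod F \<boxtimes> xprod P)"
    if "card F = card P" for P F
    using that unfolding assms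
    by (simp add: sum_distrib_left sum_distrib_right scl_mult_left scl_mult_right pair_commute)
  then have "(1 + (\<Sum>(P, F) \<in> {(P, F). P \<noteq> {} \<and> F \<noteq> {} \<and> card F = card P}.
      ((-1) ^ (card P * (card P - 1) div 2) * minor A P F) *\<^sub>k (gen_g ^ card P * xprod F \<boxtimes> xprod P))) * \<chi> =
    \<chi> * (1 + (\<Sum>(P, F) \<in> {(P, F). P \<noteq> {} \<and> F \<noteq> {} \<and> card F = card P}.
      ((-1) ^ (card P * (card P - 1) div 2) * minor A P F) *\<^sub>k (gen_g ^ card P * xprod F \<boxtimes> xprod P)))"
    by (auto simp: distrib_left distrib_right sum_distrib_left sum_distrib_right scl_mult_left
        scl_mult_right intro!: sum.cong)
  moreover have "(1/2) *\<^sub>k R0 * \<chi> =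
      (\<Sum>p\<in>UNIV. \<Sum>q\<in>UNIV. \<gamma> p q *\<^sub>k - (gen_x p \<boxtimes> gen_g * gen_x q)) * ((1/2) *\<^sub>k R0)"
    unfolding assms
    by (simp add: sum_distrib_left sum_distrib_right scl_mult_left scl_mult_right R0_twist scl_scl
        scl_sum_right mult.commute)
  ultimately show ?thesis
    unfolding R_mat_factor by (simp only: mult.assoc) (simp only: mult.assoc[symmetric])
qed

section \<open>Commutation across tensor legs\<close>

lemma commute_lincomb:
  fixes U V :: "'s \<Rightarrow> 't \<Rightarrow> ('k::comm_ring_1, 'b::alg_basis) alg"
  assumes "\<And>p q r s. U p q * V r s = V r s * U p q"
  shows "(\<Sum>p\<in>S. \<Sum>q\<in>T. c p q *\<^sub>k U p q) * (\<Sum>r\<in>S'. \<Sum>s\<in>T'. d r s *\<^sub>k V r s) =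
    (\<Sum>r\<in>S'. \<Sum>s\<in>T'. d r s *\<^sub>k V r s) * (\<Sum>p\<in>S. \<Sum>q\<in>T. c p q *\<^sub>k U p q)"
proof -
  define v where "v = (\<Sum>r\<in>S'. \<Sum>s\<in>T'. d r s *\<^sub>k V r s)"
  have "U p q * v = v * U p q" for p q
    unfolding v_def
    by (simp add: sum_distrib_left sum_distrib_right scl_mult_left scl_mult_right assms)
  then show ?thesis
    unfolding v_def[symmetric]
    by (simp add: sum_distrib_left sum_distrib_right scl_mult_left scl_mult_right)
qed

text \<open>The two elements overlap in one leg only (the first, respectively the third). There some
  x_i meets some g x_j, and the signs from passing g and x_j cancel.\<close>

lemma leg_commute:
  fixes p q r s :: "'n::{finite, linorder}"
  shows "leg12 (- (gen_x p \<boxtimes> gen_g * gen_x q)) * leg13 (gen_g * gen_x r \<boxtimes> gen_x s) =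
      leg13 (gen_g * gen_x r \<boxtimes> gen_x s) * (leg12 (- (gen_x p \<boxtimes> gen_g * gen_x q)) :: ('k::comm_ring_1, _) alg)"
    and "leg23 (- (gen_x p \<boxtimes> gen_g * gen_x q)) * leg13 (gen_g * gen_x r \<boxtimes> gen_x s) =
      leg13 (gen_g * gen_x r \<boxtimes> gen_x s) * (leg23 (- (gen_x p \<boxtimes> gen_g * gen_x q)) :: ('k, _) alg)"
proof -
  let ?g = "gen_g :: ('k, 'n mono) alg" and ?x = "gen_x :: 'n \<Rightarrow> ('k, 'n mono) alg"
  have xg: "?x i * ?g = - (?g * ?x i)" for i by (simp add: E_relations(3))
  have "?x i * (?g * ?x j) = ?g * ?x j * ?x i" for i j
  proof -
    have "?x i * (?g * ?x j) = - (?g * (?x i * ?x j))"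
      by (simp add: mult.assoc[symmetric] xg)
    also have "?x i * ?x j = - (?x j * ?x i)"
      by (rule E_relations(4))
    finally show ?thesis by (simp add: mult.assoc)
  qed
  then show "leg12 (- (?x p \<boxtimes> ?g * ?x q)) * leg13 (?g * ?x r \<boxtimes> ?x s) =
      leg13 (?g * ?x r \<boxtimes> ?x s) * leg12 (- (?x p \<boxtimes> ?g * ?x q))"
    "leg23 (- (?x p \<boxtimes> ?g * ?x q)) * leg13 (?g * ?x r \<boxtimes> ?x s) =
      leg13 (?g * ?x r \<boxtimes> ?x s) * leg23 (- (?x p \<boxtimes> ?g * ?x q))"
    by (simp_all add: alg_hom.hom_minus[OF alg_hom_leg12] alg_hom.hom_minus[OF alg_hom_leg23]
        leg_tensor tensor_mult)
qed

text \<open>Since k! divides n! for k \<le> n, \<open>fact_n\<close> makes the factors 1/k! genuine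
  inverses. The first conjunct confirms that \<open>exp_hbar\<close> yields the finite exponential
  sum.\<close>

theorem corollary5p3:
  fixes A \<gamma> :: "'n::{finite, linorder} \<Rightarrow> 'n \<Rightarrow> 'k::field"
    and R \<chi> :: "('k, 'n mono \<times> 'n mono) alg"
  assumes char_k: "CHAR('k) \<noteq> 2"
    and fact_n: "of_nat (fact CARD('n)) \<noteq> (0 :: 'k)"
    and R: "R = R_mat A"
    and R_quasitriangular: "quasitriangular comult R"
    and \<chi>: "\<chi> = (\<Sum>p\<in>UNIV. \<Sum>q\<in>UNIV. \<gamma> p q *\<^sub>k (gen_g * gen_x p \<boxtimes> gen_x q))"
    and \<chi>_infinitesimal: "infinitesimal_R_matrix comult R \<chi>"
  shows "fps_const R * exp_hbar \<chi> =
      fps_const R * (\<Sum>k\<le>CARD('n). fps_const ((1 / of_nat (fact k)) *\<^sub>k \<chi> ^ k) * fps_X ^ k) \<and>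
    quasitriangular_fps comult (fps_const R * exp_hbar \<chi>)"
proof
  define \<chi>' where "\<chi>' = (\<Sum>p\<in>UNIV. \<Sum>q\<in>UNIV. \<gamma> p q *\<^sub>k - (gen_x p \<boxtimes> gen_g * gen_x q))"
  \<comment> \<open>Degree is measured in a single tensor factor, since this is bounded by n while
    the total degree is not. Legs 12 and 13 share the first factor (\<open>w1\<close>), legs 13 and
    23 the third (\<open>w3\<close>).\<close>
  define w where "w = (\<lambda>b :: 'n mono \<times> 'n mono. mono_deg (fst b))"
  define w1 where "w1 = (\<lambda>b :: 'n mono \<times> 'n mono \<times> 'n mono. mono_deg (fst b))"
  define w3 where "w3 = (\<lambda>b :: 'n mono \<times> 'n mono \<times> 'n mono. mono_deg (snd (snd b)))"
  note legs = alg_hom_leg12 alg_hom_leg13 alg_hom_leg23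
  note leg_sum = alg_hom.hom_sum[OF legs(1)] alg_hom.hom_sum[OF legs(2)] alg_hom.hom_sum[OF legs(3)]
  note leg_scl = alg_hom.hom_scl[OF legs(1)] alg_hom.hom_scl[OF legs(2)] alg_hom.hom_scl[OF legs(3)]
  have w: "superadditive w" "superadditive w1" "superadditive w3"
    unfolding w_def w1_def w3_def
    by (intro superadditive_fst superadditive_mono_deg superadditive_snd[of "\<lambda>b. mono_deg (snd b)"]
        superadditive_snd)+
  have w_le: "w a \<le> CARD('n)" "w1 b \<le> CARD('n)" "w3 b \<le> CARD('n)" for a b
    by (simp_all add: w_def w1_def w3_def mono_deg_le)
  have filt: "\<chi> \<in> weight_filt w 1"
    unfolding \<chi> w_def
    by (intro weight_filt_sum weight_filt_scl weight_filt_tensor g_x_filt)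
  have filt1: "leg12 \<chi> \<in> weight_filt w1 1" "leg13 \<chi> \<in> weight_filt w1 1"
    unfolding \<chi> w1_def leg_sum leg_scl leg_tensor
    by (intro weight_filt_sum weight_filt_scl weight_filt_tensor g_x_filt)+
  have filt3: "leg23 \<chi> \<in> weight_filt w3 1" "leg13 \<chi> \<in> weight_filt w3 1"
    unfolding \<chi> w3_def leg_sum leg_scl leg_tensor
    by (intro weight_filt_sum weight_filt_scl gen_x_filt
        weight_filt_tensor(2)[where w' = "\<lambda>b. mono_deg (snd b)"] weight_filt_tensor(2))+

  have "exp_hbar \<chi> = (\<Sum>k\<le>CARD('n). fps_const ((1 / of_nat (fact k)) *\<^sub>k \<chi> ^ k) * fps_X ^ k)"
  proof (rule fps_ext)
    fix m
    \<comment> \<open>So the series stops at degree n, whatever value 1/m! takes beyond it.\<close>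
    have "\<chi> ^ m = 0" if "CARD('n) < m"
      using weight_filt_power[OF w(1) filt, of m] w_le(1) that
      by (metis weight_filt_eq_0 le_less_trans)
    then show "fps_nth (exp_hbar \<chi>) m =
        fps_nth (\<Sum>k\<le>CARD('n). fps_const ((1 / of_nat (fact k)) *\<^sub>k \<chi> ^ k) * fps_X ^ k) m"
      by (simp add: exp_hbar_def fps_sum_nth fps_X_power_nth scl_zero_right
          if_distrib[of "\<lambda>x. _ * x"] cong: if_cong)
  qed
  then show "fps_const R * exp_hbar \<chi> =
      fps_const R * (\<Sum>k\<le>CARD('n). fps_const ((1 / of_nat (fact k)) *\<^sub>k \<chi> ^ k) * fps_X ^ k)"
    by simp

  from R_quasitriangular have inv: "mult_invertible R"
    and twist: "flip (comult h) = R * comult h * mult_inv R"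
    and hexagon: "id_tensor comult R = leg13 R * leg12 R" "tensor_id comult R = leg13 R * leg23 R" for h
    by (simp_all add: quasitriangular_def R_matrix_axioms_def)
  from \<chi>_infinitesimal have \<chi>_comult: "\<chi> * comult h = comult h * \<chi>"
    and \<chi>_hexagon: "id_tensor comult \<chi> = leg12 \<chi> + mult_inv (leg12 R) * leg13 \<chi> * leg12 R"
      "tensor_id comult \<chi> = leg23 \<chi> + mult_inv (leg23 R) * leg13 \<chi> * leg23 R" for h
    by (simp_all add: infinitesimal_R_matrix_def)
  have \<chi>': "R * \<chi> = \<chi>' * R"
    unfolding R \<chi>'_def by (rule R_mat_twist[OF \<chi>])
  have comm: "leg12 \<chi>' * leg13 \<chi> = leg13 \<chi> * leg12 \<chi>'" "leg23 \<chi>' * leg13 \<chi> = leg13 \<chi> * leg23 \<chi>'"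
    unfolding \<chi> \<chi>'_def leg_sum leg_scl by (intro commute_lincomb leg_commute)+

  define E where "E = fps_const R * exp_hbar \<chi>"
  define E' where "E' = exp_hbar (- \<chi>) * fps_const (mult_inv R)"
  have EE': "E * E' = 1" "E' * E = 1"
  proof -
    note e = exp_hbar_inverse[OF fact_n w(1) w_le(1) filt]
    have r: "fps_const R * fps_const (mult_inv R) = 1" "fps_const (mult_inv R) * fps_const R = 1"
      using mult_inv[OF inv] by simp_all
    have "E * E' = fps_const R * (exp_hbar \<chi> * exp_hbar (- \<chi>)) * fps_const (mult_inv R)"
      by (simp only: E_def E'_def mult.assoc)
    then show "E * E' = 1" by (simp only: e r mult_1_right)
    have "E' * E = exp_hbar (- \<chi>) * (fps_const (mult_inv R) * fps_const R) * exp_hbar \<chi>"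
      by (simp only: E_def E'_def mult.assoc)
    then show "E' * E = 1" by (simp only: e r mult_1_right)
  qed
  \<comment> \<open>\<open>R\<close> intertwines the comultiplication with its opposite, and exp of
    \<open>\<chi>\<close> commutes with the image of the comultiplication because
    \<open>\<chi>\<close> does. The axiom itself follows on multiplying by \<open>E'\<close> from
    the right.\<close>
  have "fps_map flip (fps_map comult h) * E = E * fps_map comult h" for h
  proof -
    have "flip (comult u) * R = R * comult u" for u
      unfolding twist by (simp add: mult.assoc mult_inv(2)[OF inv])
    then have "fps_map flip (fps_map comult h) * fps_const R = fps_const R * fps_map comult h"
      by (intro fps_ext) (simp add: fps_map_def)
    then have "fps_map flip (fps_map comult h) * E = fps_const R * (fps_map comult h * exp_hbar \<chi>)"
      by (simp only: E_def mult.assoc[symmetric])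
    also have "fps_map comult h * exp_hbar \<chi> = exp_hbar \<chi> * fps_map comult h"
      by (rule exp_hbar_commute[symmetric]) (simp add: fps_map_def \<chi>_comult)
    finally show ?thesis
      by (simp only: E_def mult.assoc)
  qed
  then have "fps_map flip (fps_map comult h) * (E * E') = E * fps_map comult h * E'" for h
    by (simp only: mult.assoc[symmetric])
  then have "fps_map flip (fps_map comult h) = E * fps_map comult h * E'" for h
    by (simp only: EE' mult_1_right)
  moreover have "fps_map (id_tensor comult) E = fps_map leg13 E * fps_map leg12 E"
    unfolding E_def
    by (rule exp_hbar_hexagon[where w = w1])
      (fact alg_hom_id_tensor[OF alg_hom_comult] legs inv hexagon \<chi>_hexagon \<chi>' comm fact_n w w_le filt1)+
  moreover have "fps_map (tensor_id comult) E = fps_map leg13 E * fps_map leg23 E"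
    unfolding E_def
    by (rule exp_hbar_hexagon[where w = w3])
      (fact alg_hom_tensor_id[OF alg_hom_comult] legs inv hexagon \<chi>_hexagon \<chi>' comm fact_n w w_le filt3)+
  ultimately show "quasitriangular_fps comult (fps_const R * exp_hbar \<chi>)"
    using EE' unfolding E_def[symmetric] quasitriangular_fps_def R_matrix_axioms_def mult_invertible_def
    by (auto simp: mult_inv_eqI)
qed

end
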